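(* Let $D=(0,1)$, $\alpha\in(3/2,2)$, $V=H^1_0(D)$, $q\in L^\infty(D)$, $p\in L^2(D)$, $f\in L^2(D)$. Let $A=a+b$ with $a(\psi,\varphi)=(\psi',\varphi')$ and $b(\psi,\varphi)=({}_0^RD_x^{2-\alpha}\psi,q\varphi)+({}_0^RD_x^{2-\alpha}\psi)(1)(p,\varphi)$ on $V\times V$, and assume: (a) $A(w,v)=0$ for all $v\in V$ implies $w=0$; (a$^*$) $A(w,v)=0$ for all $w\in V$ implies $v=0$. Let $w\in V$ be the solution of the problem $$-w''+q\,{}_0^RD_x^{2-\alpha}w+p\,({}_0^RD_x^{2-\alpha}w)(1)=f\ \text{in }D,\qquad w(0)=w(1)=0,$$ in the weak sense $A(w,\varphi)=(f,\varphi)$ for all $\varphi\in V$. Then $w\in H^1_0(D)\cap H^2(D)$ and $\|w\|_{H^2(D)}\le c\|f\|_{L^2(D)}$ with $c$ independent of $f$. If moreover $q,f\in H^1(D)$ and $p\in H^1(D)$, then $w\in H^3(D)\cap H^1_0(D)$ and $\|w\|_{H^3(D)}\le c\|f\|_{H^1(D)}$.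
   Context: $(\cdot,\cdot)$ is the $L^2(D)$ inner product. For $\gamma>0$, $({}_0I_x^\gamma g)(x)=\frac{1}{\Gamma(\gamma)}\int_0^x(x-t)^{\gamma-1}g(t)\,dt$. For $w\in H^1_0(D)$, ${}_0^RD_x^{2-\alpha}w={}_0I_x^{\alpha-1}(w')$, i.e. $({}_0^RD_x^{2-\alpha}w)(x)=\frac{1}{\Gamma(\alpha-1)}\int_0^x(x-t)^{\alpha-2}w'(t)\,dt$, and $({}_0^RD_x^{2-\alpha}w)(1)=\frac{1}{\Gamma(\alpha-1)}\int_0^1(1-t)^{\alpha-2}w'(t)\,dt$. *)

theory Defs
  imports "HOL-Analysis.Analysis"
begin

definition D :: "real set" where "D = {0<..<1}"

definition L2 :: "(real \<Rightarrow> real) \<Rightarrow> bool" where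
  "L2 u \<longleftrightarrow> set_borel_measurable lebesgue D u \<and>
              set_integrable lebesgue D (\<lambda>x. (u x)\<^sup>2)"

definition Linf :: "(real \<Rightarrow> real) \<Rightarrow> bool" where
  "Linf u \<longleftrightarrow> set_borel_measurable lebesgue D u \<and>
              (\<exists>C. AE x in lebesgue. x \<in> D \<longrightarrow> \<bar>u x\<bar> \<le> C)"

definition l2_inner :: "(real \<Rightarrow> real) \<Rightarrow> (real \<Rightarrow> real) \<Rightarrow> real" where
  "l2_inner u v = (LINT x:D|lebesgue. u x * v x)"

definition l2_norm :: "(real \<Rightarrow> real) \<Rightarrow> real" where
  "l2_norm u = sqrt (LINT x:D|lebesgue. (u x)\<^sup>2)"

definition test_fun :: "(real \<Rightarrow> real) \<Rightarrow> bool" where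
  "test_fun \<phi> \<longleftrightarrow>
     (\<exists>ds :: nat \<Rightarrow> real \<Rightarrow> real. ds 0 = \<phi> \<and>
         (\<forall>k x. (ds k has_real_derivative ds (Suc k) x) (at x))) \<and>
     (\<exists>a b. 0 < a \<and> b < 1 \<and> (\<forall>x. x \<notin> {a..b} \<longrightarrow> \<phi> x = 0))"

definition weak_deriv :: "(real \<Rightarrow> real) \<Rightarrow> (real \<Rightarrow> real) \<Rightarrow> bool" where
  "weak_deriv u g \<longleftrightarrow>
     (\<forall>\<phi>. test_fun \<phi> \<longrightarrow>
        (LINT x:D|lebesgue. u x * deriv \<phi> x) = - (LINT x:D|lebesgue. g x * \<phi> x))"

text \<open>H^1(D) and the (a.e. unique) weak derivative u'.\<close>
definition H1 :: "(real \<Rightarrow> real) \<Rightarrow> bool" where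
  "H1 u \<longleftrightarrow> L2 u \<and> (\<exists>g. L2 g \<and> weak_deriv u g)"

definition wd :: "(real \<Rightarrow> real) \<Rightarrow> real \<Rightarrow> real" where
  "wd u = (SOME g. L2 g \<and> weak_deriv u g)"

definition H2 :: "(real \<Rightarrow> real) \<Rightarrow> bool" where
  "H2 u \<longleftrightarrow> H1 u \<and> H1 (wd u)"

definition H3 :: "(real \<Rightarrow> real) \<Rightarrow> bool" where
  "H3 u \<longleftrightarrow> H1 u \<and> H2 (wd u)"

definition H1_norm :: "(real \<Rightarrow> real) \<Rightarrow> real" where
  "H1_norm u = sqrt ((l2_norm u)\<^sup>2 + (l2_norm (wd u))\<^sup>2)"

definition H2_norm :: "(real \<Rightarrow> real) \<Rightarrow> real" where
  "H2_norm u = sqrt ((l2_norm u)\<^sup>2 + (l2_norm (wd u))\<^sup>2 + (l2_norm (wd (wd u)))\<^sup>2)"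

definition H3_norm :: "(real \<Rightarrow> real) \<Rightarrow> real" where
  "H3_norm u = sqrt ((l2_norm u)\<^sup>2 + (l2_norm (wd u))\<^sup>2 + (l2_norm (wd (wd u)))\<^sup>2
                     + (l2_norm (wd (wd (wd u))))\<^sup>2)"

definition H10 :: "(real \<Rightarrow> real) \<Rightarrow> bool" where
  "H10 u \<longleftrightarrow> H1 u \<and>
     (\<exists>\<phi> :: nat \<Rightarrow> real \<Rightarrow> real. (\<forall>n. test_fun (\<phi> n)) \<and>
        (\<lambda>n. H1_norm (\<lambda>x. \<phi> n x - u x)) \<longlonglongrightarrow> 0)"

text \<open>Riemann--Liouville derivative of order 2-alpha of w in H^1_0:
  (1/Gamma(alpha-1)) int_0^x (x-t)^(alpha-2) w'(t) dt.\<close>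
definition RL :: "real \<Rightarrow> (real \<Rightarrow> real) \<Rightarrow> real \<Rightarrow> real" where
  "RL \<alpha> w x = (1 / Gamma (\<alpha> - 1)) *
      (LINT t:{0<..<x}|lebesgue. (x - t) powr (\<alpha> - 2) * wd w t)"

definition A_form :: "real \<Rightarrow> (real \<Rightarrow> real) \<Rightarrow> (real \<Rightarrow> real)
                      \<Rightarrow> (real \<Rightarrow> real) \<Rightarrow> (real \<Rightarrow> real) \<Rightarrow> real" where
  "A_form \<alpha> q p \<psi> \<phi> =
     l2_inner (wd \<psi>) (wd \<phi>)
     + l2_inner (RL \<alpha> \<psi>) (\<lambda>x. q x * \<phi> x)
     + RL \<alpha> \<psi> 1 * l2_inner p \<phi>"

definition ae_zero :: "(real \<Rightarrow> real) \<Rightarrow> bool" where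
  "ae_zero u \<longleftrightarrow> (AE x in lebesgue. x \<in> D \<longrightarrow> u x = 0)"

end

(* Write u = w' and R u = RL alpha w = I^(alpha-1) u. Since alpha > 3/2, the kernel
   (x - t)^(alpha-2) is square integrable, so R maps L2 boundedly into bounded functions.
   Testing the weak form with test functions says that u has the weak derivative
   q R u + (R u)(1) p - f, which is in L2 with norm at most K ||u|| + ||f||: this is the H2
   regularity, and it remains to bound ||u|| by ||f||. If no such bound held, there would be
   solutions with ||u_n|| = 1 and ||f_n|| -> 0; the u_n have representatives that are bounded and
   uniformly Hoelder continuous of order 1/2, so by Arzela-Ascoli a subsequence converges
   uniformly, and the primitive of the limit is a solution of the homogeneous problem with
   derivative of norm 1, contradicting injectivity. For H3 one differentiates the equation once
   more: if u = c + int_0^x u', then (R u)' = c x^(alpha-2) / Gamma(alpha-1) + R u', again in L2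
   because alpha > 3/2. *)
theory Submission
  imports Defs "HOL-Complex_Analysis.Great_Picard"
begin

section \<open>Square integrable functions on the unit interval\<close>

text \<open>The form b is of lower order but has neither a sign nor smallness, so A need not be
  coercive: the bound of u by f can only come from injectivity together with compactness, and its
  constant is not explicit. Since the estimate is homogeneous in the pair (f, w), a failing sequence
  may be rescaled to ||w'|| = 1.

  Because \<open>wd\<close> is an arbitrary choice among a.e. equal weak derivatives, identities for
  it hold almost everywhere only. The Sobolev calculus is therefore reduced to one equivalence: u
  has weak derivative g iff u = c + J g a.e., with J g the integral of g from 0. Linearity, the
  product rule and the Hoelder representative become statements about J.

  Zero boundary values enter twice. They give w = J w' without a constant, so that convergence of
  the derivatives carries the functions along; and \<open>H10\<close> is closed under H1
  convergence, so that the primitive of the limit is admissible in the injectivity hypothesis. L2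
  convergence of the derivatives is enough to pass to the limit, because A depends on its first
  argument through the derivative alone.\<close>

abbreviation M :: "real measure" where "M \<equiv> lebesgue_on D"

lemma D_sets [measurable, simp]: "D \<in> sets lebesgue"
  by (simp add: D_def)

lemma set_integral_D: "(LINT x:D|lebesgue. f x) = (LINT x|M. f x)" for f :: "real \<Rightarrow> real"
  by (simp add: integral_restrict_space set_lebesgue_integral_def)

lemma AE_D: "(AE x in lebesgue. x \<in> D \<longrightarrow> P x) \<longleftrightarrow> (AE x in M. P x)"
  by (simp add: AE_restrict_space_iff)

lemma AE_DI: "(\<And>x. x \<in> D \<Longrightarrow> P x) \<Longrightarrow> AE x in M. P x"
  by (rule AE_I2) simp

lemma set_borel_measurable_D: "set_borel_measurable lebesgue D u \<longleftrightarrow> u \<in> borel_measurable M"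
  for u :: "real \<Rightarrow> real"
  unfolding set_borel_measurable_def using borel_measurable_restrict_space_iff[of D lebesgue u] by simp

lemma set_integrable_D: "set_integrable lebesgue D u \<longleftrightarrow> integrable M u"
  for u :: "real \<Rightarrow> real"
  unfolding set_integrable_def using integrable_restrict_space[of D lebesgue u] by simp

lemma L2_iff: "L2 u \<longleftrightarrow> u \<in> borel_measurable M \<and> integrable M (\<lambda>x. (u x)\<^sup>2)"
  by (simp add: L2_def set_borel_measurable_D set_integrable_D)

lemma L2_measurable [measurable_dest]: "L2 u \<Longrightarrow> u \<in> borel_measurable M"
  by (simp add: L2_iff)

lemma Linf_measurable [measurable_dest]: "Linf u \<Longrightarrow> u \<in> borel_measurable M"
  by (simp add: Linf_def set_borel_measurable_D)

lemma l2_inner_eq: "l2_inner u v = (LINT x|M. u x * v x)"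
  by (simp add: l2_inner_def set_integral_D)

lemma l2_norm_eq: "l2_norm u = sqrt (LINT x|M. (u x)\<^sup>2)"
  by (simp add: l2_norm_def set_integral_D)

lemma weak_deriv_iff: "weak_deriv u g \<longleftrightarrow>
    (\<forall>\<phi>. test_fun \<phi> \<longrightarrow> (LINT x|M. u x * deriv \<phi> x) = - (LINT x|M. g x * \<phi> x))"
  by (simp add: weak_deriv_def set_integral_D)

lemma emeasure_M: "emeasure M (space M) = 1"
  by (simp add: emeasure_restrict_space D_def)

interpretation M: finite_measure M
  by (rule finite_measureI) (simp only: emeasure_M, simp)

interpretation MM: pair_sigma_finite M M ..

lemma measure_M [simp]: "measure M (space M) = 1" "measure M D = 1"
  using emeasure_M by (simp_all add: measure_def)

lemma borel_imp_M: "f \<in> borel_measurable borel \<Longrightarrow> f \<in> borel_measurable M" for f :: "real \<Rightarrow> real"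
  by (intro measurable_restrict_space1 measurable_completion) simp

lemma ident_M [measurable]: "(\<lambda>x. x) \<in> borel_measurable M"
  by (rule borel_imp_M) simp

lemma L2_mult [intro]:
  assumes "L2 u" "L2 v" shows "integrable M (\<lambda>x. u x * v x)"
proof (rule Bochner_Integration.integrable_bound)
  show "integrable M (\<lambda>x. (u x)\<^sup>2 + (v x)\<^sup>2)" using assms by (simp add: L2_iff)
  have "\<bar>a * b\<bar> \<le> a\<^sup>2 + b\<^sup>2" for a b :: real
    using sum_squares_bound[of "\<bar>a\<bar>" "\<bar>b\<bar>"] mult_nonneg_nonneg[OF abs_ge_zero[of a] abs_ge_zero[of b]]
    unfolding abs_mult power2_abs by linarith
  then show "AE x in M. norm (u x * v x) \<le> norm ((u x)\<^sup>2 + (v x)\<^sup>2)" by simp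
qed (use assms in measurable)

lemma L2_bounded:
  assumes [measurable]: "u \<in> borel_measurable M" and "AE x in M. \<bar>u x\<bar> \<le> C"
  shows "L2 u"
proof -
  have "integrable M (\<lambda>x. (u x)\<^sup>2)"
  proof (rule M.integrable_const_bound[where B = "C\<^sup>2"])
    show "AE x in M. norm ((u x)\<^sup>2) \<le> C\<^sup>2"
      using assms(2) by eventually_elim (simp, metis abs_ge_zero power2_abs power_mono)
  qed simp
  then show ?thesis by (simp add: L2_iff)
qed

lemma L2_const [simp, intro]: "L2 (\<lambda>x. c)"
  by (rule L2_bounded[where C = "\<bar>c\<bar>"]) auto

lemma L2_integrable [intro]: "L2 u \<Longrightarrow> integrable M u"
  using L2_mult[of u "\<lambda>x. 1"] by auto

lemma L2_add [intro]:
  assumes "L2 u" "L2 v" shows "L2 (\<lambda>x. u x + v x)"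
  using assms L2_mult[OF assms] by (auto simp: L2_iff power2_sum mult.assoc)

lemma L2_cmult [intro]:
  assumes "L2 u" shows "L2 (\<lambda>x. c * u x)"
  using assms by (auto simp: L2_iff power_mult_distrib)

lemma L2_uminus [intro]: "L2 u \<Longrightarrow> L2 (\<lambda>x. - u x)"
  using L2_cmult[of u "-1"] by simp

lemma L2_diff [intro]: "L2 u \<Longrightarrow> L2 v \<Longrightarrow> L2 (\<lambda>x. u x - v x)"
  using L2_add[of u "\<lambda>x. - v x"] by auto

lemma L2_AE_mult:
  assumes "L2 u" and [measurable]: "q \<in> borel_measurable M" and "AE x in M. \<bar>q x\<bar> \<le> C"
  shows "L2 (\<lambda>x. q x * u x)"
proof -
  note [measurable] = L2_measurable[OF assms(1)]
  have "integrable M (\<lambda>x. (q x * u x)\<^sup>2)"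
  proof (rule Bochner_Integration.integrable_bound)
    show "integrable M (\<lambda>x. C\<^sup>2 * (u x)\<^sup>2)" using assms by (simp add: L2_iff)
    show "AE x in M. norm ((q x * u x)\<^sup>2) \<le> norm (C\<^sup>2 * (u x)\<^sup>2)"
      using assms(3)
    proof eventually_elim
      case (elim x)
      then have "(q x)\<^sup>2 \<le> C\<^sup>2" by (metis abs_ge_zero power2_abs power_mono)
      then show ?case by (simp add: power_mult_distrib mult_right_mono)
    qed
  qed measurable
  then show ?thesis by (simp add: L2_iff)
qed

lemma l2_norm_sq: "(l2_norm u)\<^sup>2 = l2_inner u u"
  by (simp add: l2_norm_eq l2_inner_eq power2_eq_square)

lemma l2_norm_nonneg [simp]: "0 \<le> l2_norm u"
  by (simp add: l2_norm_eq)

text \<open>The discriminant argument at t = B / C, with the degenerate leading coefficients treated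
  by hand: C = 0 forces B = 0, and C < 0 makes the quadratic negative for large t. Applied to t ->
  ||u - t v||^2 it yields Cauchy-Schwarz.\<close>

lemma nonneg_quadratic_discriminant:
  fixes A B C :: real
  assumes "\<And>t. 0 \<le> A - 2 * t * B + t\<^sup>2 * C"
  shows "B\<^sup>2 \<le> A * C"
proof (cases "C = 0")
  case True
  have "B = 0"
  proof (rule ccontr)
    assume "B \<noteq> 0"
    \<comment> \<open>This t makes A - 2 t B equal to -1.\<close>
    with assms[of "(A + 1) / (2 * B)"] True show False by (simp add: field_simps)
  qed
  then show ?thesis using True by simp
next
  case False
  have "0 \<le> C"
  proof (rule ccontr)
    assume "\<not> 0 \<le> C"
    \<comment> \<open>Chosen so that t >= 1 and - t C >= 1 + |A| + 2 |B|; the quadratic is then at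
      most - t.\<close>
    define t where "t = (1 + \<bar>A\<bar> + 2 * \<bar>B\<bar>) / (- C) + 1"
    have t: "1 \<le> t" "t * (- C) \<ge> 1 + \<bar>A\<bar> + 2 * \<bar>B\<bar>"
      using \<open>\<not> 0 \<le> C\<close> by (auto simp: t_def field_simps divide_nonneg_neg)
    have "t * (1 + \<bar>A\<bar> + 2 * \<bar>B\<bar>) \<le> t * (t * (- C))" using t by (intro mult_left_mono) auto
    moreover have "t * \<bar>A\<bar> \<ge> \<bar>A\<bar>" using t by (metis abs_ge_zero mult_1 mult_right_mono)
    moreover have "t * B \<ge> - (t * \<bar>B\<bar>)" using t by (metis abs_ge_minus_self abs_minus_commute minus_le_iff mult_left_mono mult_minus_right zero_le_one order_trans)
    ultimately show False using assms[of t] t by (simp add: algebra_simps power2_eq_square)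
  qed
  then show ?thesis using assms[of "B / C"] False by (simp add: field_simps power2_eq_square)
qed

lemma l2_Cauchy_Schwarz:
  assumes "L2 u" "L2 v" shows "\<bar>l2_inner u v\<bar> \<le> l2_norm u * l2_norm v"
proof -
  have "0 \<le> l2_inner u u - 2 * t * l2_inner u v + t\<^sup>2 * l2_inner v v" for t
  proof -
    have "0 \<le> (LINT x|M. (u x - t * v x)\<^sup>2)" by (rule integral_nonneg_AE) simp
    also have "\<dots> = (LINT x|M. u x * u x - 2 * t * (u x * v x) + t\<^sup>2 * (v x * v x))"
      by (intro Bochner_Integration.integral_cong) (auto simp: algebra_simps power2_eq_square)
    also have "\<dots> = l2_inner u u - 2 * t * l2_inner u v + t\<^sup>2 * l2_inner v v"
      unfolding l2_inner_eq using assms by (subst Bochner_Integration.integral_add Bochner_Integration.integral_diff; (intro Bochner_Integration.integrable_diff integrable_mult_right L2_mult)?; simp)+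
    finally show ?thesis .
  qed
  from nonneg_quadratic_discriminant[OF this] have "(l2_inner u v)\<^sup>2 \<le> (l2_norm u * l2_norm v)\<^sup>2"
    by (simp add: power_mult_distrib l2_norm_sq)
  then have "\<bar>l2_inner u v\<bar> \<le> \<bar>l2_norm u * l2_norm v\<bar>" by (simp only: abs_le_square_iff)
  then show ?thesis by (simp add: abs_mult)
qed

lemma l2_norm_triangle:
  assumes "L2 u" "L2 v" shows "l2_norm (\<lambda>x. u x + v x) \<le> l2_norm u + l2_norm v"
proof -
  have "(l2_norm (\<lambda>x. u x + v x))\<^sup>2 = (LINT x|M. u x * u x + 2 * (u x * v x) + v x * v x)"
    unfolding l2_norm_sq l2_inner_eq
    by (intro Bochner_Integration.integral_cong) (auto simp: algebra_simps power2_eq_square)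
  also have "\<dots> = l2_inner u u + 2 * l2_inner u v + l2_inner v v"
    unfolding l2_inner_eq using assms by (subst Bochner_Integration.integral_add; (intro Bochner_Integration.integrable_add integrable_mult_right L2_mult)?; simp)+
  also have "\<dots> \<le> (l2_norm u + l2_norm v)\<^sup>2"
    using l2_Cauchy_Schwarz[OF assms] by (simp add: power2_sum flip: l2_norm_sq)
  finally show ?thesis by (rule power2_le_imp_le) auto
qed

lemma l2_norm_cmult: "l2_norm (\<lambda>x. c * u x) = \<bar>c\<bar> * l2_norm u"
  by (simp add: l2_norm_eq power_mult_distrib real_sqrt_mult)

lemma l2_norm_uminus [simp]: "l2_norm (\<lambda>x. - u x) = l2_norm u"
  by (simp add: l2_norm_eq)

lemma l2_norm_triangle_diff:
  assumes "L2 u" "L2 v" shows "l2_norm (\<lambda>x. u x - v x) \<le> l2_norm u + l2_norm v"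
  using l2_norm_triangle[OF assms(1) L2_uminus[OF assms(2)]] by simp

lemma l2_norm_cong_AE:
  assumes "L2 u" "L2 v" "AE x in M. u x = v x" shows "l2_norm u = l2_norm v"
  unfolding l2_norm_eq using assms
  by (intro arg_cong[where f = sqrt] integral_cong_AE) (auto simp: L2_iff)

lemma l2_norm_mono:
  assumes "L2 v" "u \<in> borel_measurable M" "AE x in M. \<bar>u x\<bar> \<le> \<bar>v x\<bar>"
  shows "l2_norm u \<le> l2_norm v"
  unfolding l2_norm_eq using assms
  by (auto intro!: integral_mono_AE' simp: L2_iff abs_le_square_iff)

lemma l2_norm_const [simp]: "l2_norm (\<lambda>x. c) = \<bar>c\<bar>"
  by (simp add: l2_norm_eq)

lemma l2_norm_bounded:
  assumes "u \<in> borel_measurable M" "AE x in M. \<bar>u x\<bar> \<le> C" "0 \<le> C"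
  shows "l2_norm u \<le> C"
  using l2_norm_mono[OF L2_const[of C], of u] assms by auto

lemma l2_norm_eq_0_iff:
  assumes "L2 u" shows "l2_norm u = 0 \<longleftrightarrow> (AE x in M. u x = 0)"
  unfolding l2_norm_eq using assms
  by (subst real_sqrt_eq_zero_cancel_iff, subst integral_nonneg_eq_0_iff_AE) (auto simp: L2_iff)

lemma L2_cong_AE:
  assumes v: "L2 v" and [measurable]: "u \<in> borel_measurable M" and uv: "AE x in M. u x = v x"
  shows "L2 u"
proof -
  have "integrable M (\<lambda>x. (u x)\<^sup>2)"
  proof (rule integrable_cong_AE_imp)
    show "integrable M (\<lambda>x. (v x)\<^sup>2)" using v by (simp add: L2_iff)
    show "AE x in M. (v x)\<^sup>2 = (u x)\<^sup>2" using uv by eventually_elim simp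
  qed measurable
  then show ?thesis by (simp add: L2_iff)
qed

section \<open>Primitives of functions on the unit interval\<close>

text \<open>The cut-off sits in the integrand over the fixed measure \<open>M\<close> and not in the
  domain of integration, so that measurability in x and Fubini on the product of \<open>M\<close>
  with itself apply directly. The function is total: 0 left of the interval, the full integral right
  of it.\<close>

definition J :: "(real \<Rightarrow> real) \<Rightarrow> real \<Rightarrow> real" where
  "J g x = (LINT t|M. (if t < x then g t else 0))"

lemma integrable_if [intro]:
  fixes g :: "real \<Rightarrow> real"
  assumes g: "integrable M g" and [measurable]: "Measurable.pred M P"
  shows "integrable M (\<lambda>t. if P t then g t else 0)"
proof (rule Bochner_Integration.integrable_bound[OF g])
  have [measurable]: "g \<in> borel_measurable M" using g by auto
  show "(\<lambda>t. if P t then g t else 0) \<in> borel_measurable M" by measurable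
qed auto

lemma J_0 [simp]: "x \<le> 0 \<Longrightarrow> J g x = 0"
  unfolding J_def by (intro integral_eq_zero_AE AE_I2) (auto simp: D_def)

lemma J_1: "1 \<le> x \<Longrightarrow> J g x = (LINT t|M. g t)"
  unfolding J_def by (intro Bochner_Integration.integral_cong) (auto simp: D_def)

lemma J_add: "integrable M f \<Longrightarrow> integrable M g \<Longrightarrow> J (\<lambda>t. f t + g t) x = J f x + J g x"
  unfolding J_def by (subst Bochner_Integration.integral_add[symmetric])
    (auto intro!: Bochner_Integration.integral_cong integrable_if)

lemma if_zero_mult:
  "(if P then c * a else 0) = c * (if P then a else (0::real))"
  "(if P then a * c else 0) = (if P then a else (0::real)) * c"
  by auto

lemma J_cmult: "J (\<lambda>t. c * f t) x = c * J f x"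
  unfolding J_def if_zero_mult by (rule integral_mult_right_zero)

lemma J_uminus: "J (\<lambda>t. - f t) x = - J f x"
  using J_cmult[of "-1" f x] by simp

lemma J_diff: "integrable M f \<Longrightarrow> integrable M g \<Longrightarrow> J (\<lambda>t. f t - g t) x = J f x - J g x"
  using J_add[of f "\<lambda>t. - g t" x] by (simp add: J_uminus)

lemma J_cong_AE:
  assumes [measurable]: "f \<in> borel_measurable M" "g \<in> borel_measurable M"
    and fg: "AE x in M. f x = g x"
  shows "J f x = J g x"
  unfolding J_def
proof (rule integral_cong_AE)
  show "AE t in M. (if t < x then f t else 0) = (if t < x then g t else 0)"
    using fg by eventually_elim simp
qed measurable

lemma J_measurable [measurable]:
  assumes [measurable]: "g \<in> borel_measurable M"
  shows "J g \<in> borel_measurable M"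
  unfolding J_def by measurable

lemma J_one: "x \<in> {0..1} \<Longrightarrow> J (\<lambda>t. 1) x = x"
proof -
  assume x: "x \<in> {0..1}"
  have "J (\<lambda>t. 1) x = (LINT t|M. indicator {0<..<x} t)"
    unfolding J_def by (intro Bochner_Integration.integral_cong) (auto simp: D_def)
  also have "\<dots> = x"
    using x by (simp add: D_def measure_restrict_space Int_absorb1 subset_eq)
  finally show ?thesis .
qed

text \<open>Cauchy-Schwarz against the indicator of [x, y), whose L2 norm is sqrt (y - x). This is
  the source of the Hoelder exponent 1/2 and of the equicontinuity used for compactness.\<close>

lemma J_Hoelder_less:
  assumes "L2 g" "0 \<le> x" "x \<le> y" "y \<le> 1"
  shows "\<bar>J g y - J g x\<bar> \<le> sqrt (y - x) * l2_norm g"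
proof -
  let ?k = "\<lambda>t. if x \<le> t \<and> t < y then 1 else 0 :: real"
  have k: "L2 ?k" by (rule L2_bounded[where C = 1]) auto
  have i1: "J g y - J g x = l2_inner ?k g"
    unfolding J_def l2_inner_eq using assms
    by (subst Bochner_Integration.integral_diff[symmetric])
      (auto intro!: Bochner_Integration.integral_cong integrable_if)
  have "(l2_norm ?k)\<^sup>2 = J (\<lambda>t. 1) y - J (\<lambda>t. 1) x"
    unfolding J_def l2_norm_sq l2_inner_eq using assms
    by (subst Bochner_Integration.integral_diff[symmetric])
      (auto intro!: Bochner_Integration.integral_cong integrable_if)
  also have "\<dots> = y - x" using assms by (simp add: J_one)
  finally have sq: "(l2_norm ?k)\<^sup>2 = y - x" .
  have "l2_norm ?k = sqrt ((l2_norm ?k)\<^sup>2)" by simp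
  then have "l2_norm ?k = sqrt (y - x)" by (simp only: sq)
  then show ?thesis using l2_Cauchy_Schwarz[OF k assms(1)] i1 by simp
qed

lemma J_Hoelder:
  assumes "L2 g" "x \<in> {0..1}" "y \<in> {0..1}"
  shows "\<bar>J g x - J g y\<bar> \<le> sqrt \<bar>x - y\<bar> * l2_norm g"
  using J_Hoelder_less[OF assms(1), of x y] J_Hoelder_less[OF assms(1), of y x] assms(2,3)
  by (cases "x \<le> y") (auto simp: abs_minus_commute)

lemma J_bound:
  assumes "L2 g" "x \<in> {0..1}" shows "\<bar>J g x\<bar> \<le> l2_norm g"
proof -
  have "\<bar>J g x\<bar> \<le> sqrt x * l2_norm g" using J_Hoelder[OF assms(1), of x 0] assms(2) by simp
  also have "\<dots> \<le> 1 * l2_norm g" using assms by (intro mult_right_mono) auto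
  finally show ?thesis by simp
qed

lemma D_imp_Icc: "x \<in> D \<Longrightarrow> x \<in> {0..1}"
  by (auto simp: D_def)

lemma J_L2 [intro]: assumes "L2 g" shows "L2 (J g)"
proof (rule L2_bounded)
  show "J g \<in> borel_measurable M" using assms by measurable
  show "AE x in M. \<bar>J g x\<bar> \<le> l2_norm g" using J_bound[OF assms D_imp_Icc] by (rule AE_DI)
qed

lemma J_norm: assumes "L2 g" shows "l2_norm (J g) \<le> l2_norm g"
proof (rule l2_norm_bounded)
  show "J g \<in> borel_measurable M" using assms by measurable
  show "AE x in M. \<bar>J g x\<bar> \<le> l2_norm g" using J_bound[OF assms D_imp_Icc] by (rule AE_DI)
qed simp

lemma L2_continuous:
  assumes "continuous_on UNIV f" shows "L2 f"
proof -
  have "compact (f ` {0..1})"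
    by (intro compact_continuous_image continuous_on_subset[OF assms]) auto
  then have "bounded (f ` {0..1})" by (rule compact_imp_bounded)
  then obtain C where C: "\<forall>y\<in>f ` {0..1}. norm y \<le> C"
    unfolding bounded_iff by blast
  have "AE x in M. \<bar>f x\<bar> \<le> C"
    using bspec[OF C imageI[OF D_imp_Icc]] by (intro AE_DI) (simp only: real_norm_def)
  moreover have "f \<in> borel_measurable M"
    by (rule borel_imp_M[OF borel_measurable_continuous_onI[OF assms]])
  ultimately show ?thesis by (rule L2_bounded[rotated])
qed

text \<open>The fundamental theorem speaks of the gauge integral on a closed interval,
  \<open>J\<close> of the Lebesgue integral on \<open>D\<close>. Extended by 0 to the line, the two
  integrands differ at finitely many points, and uniqueness of the gauge integral identifies the
  values.\<close>

lemma J_FTC: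
  assumes F: "\<And>x. (F has_real_derivative f x) (at x)" and f: "continuous_on UNIV f"
    and x: "x \<in> {0..1}"
  shows "J f x = F x - F 0"
proof -
  have "(f has_integral (F x - F 0)) {0..x}"
    using x F by (intro fundamental_theorem_of_calculus)
      (auto simp: has_real_derivative_iff_has_vector_derivative[symmetric] intro: DERIV_subset)
  then have "((\<lambda>t. if t \<in> {0..x} then f t else 0) has_integral (F x - F 0)) UNIV"
    by (simp only: has_integral_restrict_UNIV)
  then have 1: "((\<lambda>t. if t \<in> D then if t < x then f t else 0 else 0) has_integral (F x - F 0)) UNIV"
    by (rule has_integral_spike_finite[where S = "{0, x, 1}", rotated 2]) (use x in \<open>auto simp: D_def\<close>)
  have "((\<lambda>t. if t < x then f t else 0) has_integral J f x) D"
    unfolding J_def using L2_continuous[OF f]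
    by (intro has_integral_integral_lebesgue_on integrable_if) auto
  then have "((\<lambda>t. if t \<in> D then if t < x then f t else 0 else 0) has_integral (J f x)) UNIV"
    by (simp only: has_integral_restrict_UNIV)
  from has_integral_unique[OF this 1] show ?thesis .
qed

section \<open>Fubini on the triangle, integration by parts, product rule\<close>

lemma integrable_MM_mult:
  fixes f g :: "real \<Rightarrow> real"
  assumes f: "integrable M f" and g: "integrable M g"
  shows "integrable (M \<Otimes>\<^sub>M M) (\<lambda>(s, y). f s * g y)"
proof -
  have [measurable]: "f \<in> borel_measurable M" "g \<in> borel_measurable M" using f g by auto
  show ?thesis
    using f g by (intro MM.Fubini_integrable) (auto simp: norm_mult abs_mult)
qed

lemma AE_neq: "AE y in M. y \<noteq> s"
proof -
  have "AE y in lebesgue. y \<noteq> s"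
    using AE_completion[of "\<lambda>y. y \<noteq> s" lborel] AE_lborel_singleton by auto
  then show ?thesis by (auto simp: AE_restrict_space_iff elim: eventually_mono)
qed

lemma integral_greater:
  fixes b :: "real \<Rightarrow> real"
  assumes b: "integrable M b"
  shows "(LINT y|M. (if s < y then b y else 0)) = (LINT y|M. b y) - J b s"
proof -
  have [measurable]: "b \<in> borel_measurable M" using b by auto
  have "(LINT y|M. b y) - J b s = (LINT y|M. b y - (if y < s then b y else 0))"
    unfolding J_def using b by (intro Bochner_Integration.integral_diff[symmetric]) auto
  also have "\<dots> = (LINT y|M. (if s < y then b y else 0))"
    using AE_neq[of s] by (intro integral_cong_AE) (auto elim!: eventually_mono)
  finally show ?thesis by simp
qed

text \<open>Fubini on the triangle s < y: exchanging the order replaces the primitive of a by the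
  tail integral of b, which is the total integral minus \<open>J b s\<close>.\<close>

lemma J_by_parts:
  assumes a: "integrable M a" and b: "integrable M b"
  shows "(LINT y|M. J a y * b y) = (LINT s|M. a s * ((LINT y|M. b y) - J b s))"
proof -
  have [measurable]: "a \<in> borel_measurable M" "b \<in> borel_measurable M" using a b by auto
  have "(LINT y|M. J a y * b y) = (LINT y|M. LINT s|M. (if s < y then a s * b y else 0))"
    unfolding J_def if_zero_mult(2) integral_mult_left_zero ..
  also have "\<dots> = (LINT s|M. LINT y|M. (if s < y then a s * b y else 0))"
  proof (rule MM.Fubini_integral)
    show "integrable (M \<Otimes>\<^sub>M M) (\<lambda>(s, y). if s < y then a s * b y else 0)"
      by (rule Bochner_Integration.integrable_bound[OF integrable_MM_mult[OF a b]]) auto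
  qed
  also have "\<dots> = (LINT s|M. a s * ((LINT y|M. b y) - J b s))"
    unfolding integral_greater[OF b, symmetric] if_zero_mult(1) integral_mult_right_zero ..
  finally show ?thesis .
qed

lemma integrable_J_mult:
  assumes a: "integrable M a" and b: "integrable M b"
  shows "integrable M (\<lambda>y. J a y * b y)"
proof (rule Bochner_Integration.integrable_bound)
  have [measurable]: "a \<in> borel_measurable M" "b \<in> borel_measurable M" using a b by auto
  show "(\<lambda>y. J a y * b y) \<in> borel_measurable M" by measurable
  show "integrable M (\<lambda>y. (LINT t|M. \<bar>a t\<bar>) * b y)" using b by auto
  have "\<bar>J a y\<bar> \<le> (LINT t|M. \<bar>a t\<bar>)" for y
    unfolding J_def using a
    by (intro order_trans[OF integral_abs_bound] integral_mono integrable_abs integrable_if) auto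
  then have "\<bar>J a y\<bar> * \<bar>b y\<bar> \<le> \<bar>LINT t|M. \<bar>a t\<bar>\<bar> * \<bar>b y\<bar>" for y
    by (intro mult_right_mono) (auto intro: order_trans)
  then show "AE y in M. norm (J a y * b y) \<le> norm ((LINT t|M. \<bar>a t\<bar>) * b y)"
    by (simp add: abs_mult)
qed

text \<open>The product rule in integrated form. Cutting both functions off at x reduces it to
  \<open>J_by_parts\<close> over all of \<open>D\<close>, since the total integral of the truncated
  b is \<open>J b x\<close>.\<close>

lemma J_mult:
  assumes a: "integrable M a" and b: "integrable M b"
  shows "J a x * J b x = J (\<lambda>y. J a y * b y + a y * J b y) x"
proof -
  let ?a = "\<lambda>t. if t < x then a t else 0" and ?b = "\<lambda>t. if t < x then b t else 0"
  have a': "integrable M ?a" and b': "integrable M ?b" using a b by auto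
  \<comment> \<open>Below x the truncation is invisible to \<open>J\<close>.\<close>
  have eq: "J (\<lambda>t. if t < x then f t else 0) y = J f y" if "y < x" for f y
    unfolding J_def using that by (intro Bochner_Integration.integral_cong) auto
  have ia: "integrable M (\<lambda>s. ?a s * J ?b s)"
    using integrable_J_mult[OF b' a'] by (simp only: mult.commute)
  have "(LINT y|M. J ?a y * ?b y) = (LINT s|M. ?a s * (J b x - J ?b s))"
    using J_by_parts[OF a' b'] by (simp add: J_def)
  also have "\<dots> = (LINT s|M. ?a s * J b x - ?a s * J ?b s)" by (simp add: algebra_simps)
  also have "\<dots> = J a x * J b x - (LINT s|M. ?a s * J ?b s)"
    using a' ia by (subst Bochner_Integration.integral_diff) (auto simp: J_def)
  finally have "J a x * J b x = (LINT y|M. J ?a y * ?b y) + (LINT s|M. ?a s * J ?b s)" by simp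
  also have "\<dots> = (LINT y|M. J ?a y * ?b y + ?a y * J ?b y)"
    using ia integrable_J_mult[OF a' b'] by simp
  also have "\<dots> = J (\<lambda>y. J a y * b y + a y * J b y) x"
    unfolding J_def[of "\<lambda>y. J a y * b y + a y * J b y"]
    by (intro Bochner_Integration.integral_cong) (auto simp: eq)
  finally show ?thesis .
qed

section \<open>Test functions and weak derivatives\<close>

text \<open>Differentiability k times, organised by recursion on k so that closure under sums,
  products, exp and affine substitution is a plain induction. Level 0 is no condition at all; only
  the conjunction over all k, \<open>smooth\<close>, matters in the end.\<close>

primrec Cn :: "nat \<Rightarrow> (real \<Rightarrow> real) \<Rightarrow> bool" where
  "Cn 0 f \<longleftrightarrow> True"
| "Cn (Suc k) f \<longleftrightarrow> (\<exists>f'. (\<forall>x. (f has_real_derivative f' x) (at x)) \<and> Cn k f')"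

lemma Cn_SucI: "(\<And>x. (f has_real_derivative f' x) (at x)) \<Longrightarrow> Cn k f' \<Longrightarrow> Cn (Suc k) f"
  by auto

lemma Cn_SucD:
  assumes "Cn (Suc k) f" shows "(f has_real_derivative deriv f x) (at x)" "Cn k (deriv f)"
proof -
  from assms obtain f' where f': "\<forall>x. (f has_real_derivative f' x) (at x)" "Cn k f'" by auto
  then have "deriv f = f'" by (intro ext DERIV_imp_deriv) simp
  with f' show "(f has_real_derivative deriv f x) (at x)" "Cn k (deriv f)" by simp_all
qed

lemma Cn_lower: "Cn (Suc k) f \<Longrightarrow> Cn k f"
proof (induction k arbitrary: f)
  case (Suc k)
  show ?case by (rule Cn_SucI[OF Cn_SucD(1)[OF Suc.prems] Suc.IH[OF Cn_SucD(2)[OF Suc.prems]]])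
qed simp

lemma Cn_const: "Cn k (\<lambda>x. c)"
proof (induction k arbitrary: c)
  case (Suc k)
  show ?case by (rule Cn_SucI[OF DERIV_const Suc])
qed simp

lemma Cn_add: "Cn k f \<Longrightarrow> Cn k g \<Longrightarrow> Cn k (\<lambda>x. f x + g x)"
proof (induction k arbitrary: f g)
  case (Suc k)
  note f = Cn_SucD[OF Suc.prems(1)]
  note g = Cn_SucD[OF Suc.prems(2)]
  show ?case by (rule Cn_SucI[OF DERIV_add[OF f(1) g(1)] Suc.IH[OF f(2) g(2)]])
qed simp

lemma Cn_mult: "Cn k f \<Longrightarrow> Cn k g \<Longrightarrow> Cn k (\<lambda>x. f x * g x)"
proof (induction k arbitrary: f g)
  case (Suc k)
  note f = Cn_SucD[OF Suc.prems(1)]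
  note g = Cn_SucD[OF Suc.prems(2)]
  have "Cn k (\<lambda>x. deriv f x * g x + deriv g x * f x)"
    by (rule Cn_add[OF Suc.IH[OF f(2) Cn_lower[OF Suc.prems(2)]] Suc.IH[OF g(2) Cn_lower[OF Suc.prems(1)]]])
  then show ?case by (rule Cn_SucI[OF DERIV_mult[OF f(1) g(1)]])
qed simp

lemma Cn_exp: "Cn k f \<Longrightarrow> Cn k (\<lambda>x. exp (f x))"
proof (induction k arbitrary: f)
  case (Suc k)
  note f = Cn_SucD[OF Suc.prems]
  have "Cn k (\<lambda>x. exp (f x) * deriv f x)"
    by (rule Cn_mult[OF Suc.IH[OF Cn_lower[OF Suc.prems]] f(2)])
  then show ?case by (rule Cn_SucI[OF DERIV_chain2[OF DERIV_exp f(1)]])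
qed simp

lemma Cn_affine: "Cn k f \<Longrightarrow> Cn k (\<lambda>x. f (a * x + b))"
proof (induction k arbitrary: f)
  case (Suc k)
  note f = Cn_SucD[OF Suc.prems]
  have "Cn k (\<lambda>x. deriv f (a * x + b) * a)"
    using f Suc.IH[OF f(2)] by (intro Cn_mult Cn_const)
  moreover have "((\<lambda>x. a * x + b) has_real_derivative a) (at x)" for x
    by (auto intro!: derivative_eq_intros)
  ultimately show ?case by (intro Cn_SucI[where f' = "\<lambda>x. deriv f (a * x + b) * a"] DERIV_chain2[OF f(1)])
qed simp

(* A family closed under differentiation that contains the flat function exp (- 1 / x). *)
definition flat :: "real poly \<Rightarrow> real \<Rightarrow> real" where
  "flat P x = (if 0 < x then poly P (1 / x) * exp (- (1 / x)) else 0)"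

lemma poly_exp_tendsto_0: "((\<lambda>y. poly P y * exp (- y)) \<longlongrightarrow> 0) at_top" for P :: "real poly"
proof -
  have "((\<lambda>y. \<Sum>i\<le>degree P. coeff P i * (y ^ i / exp y)) \<longlongrightarrow> (\<Sum>i\<le>degree P. coeff P i * 0)) at_top"
    by (intro tendsto_intros tendsto_power_div_exp_0)
  then show ?thesis
    by (simp add: poly_altdef sum_distrib_right exp_minus divide_inverse mult.assoc)
qed

text \<open>With y = 1/x, the derivative of P(y) exp(-y) in x is y^2 (P - P')(y) exp(-y); the
  polynomial \<open>[:0, 0, 1:]\<close> is the factor y^2. At 0 the derivative is the limit of
  difference quotients, treated on each side separately.\<close>

lemma flat_deriv:
  "(flat P has_real_derivative flat ([:0, 0, 1:] * (P - pderiv P)) x) (at x)"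
proof (cases "x = 0")
  case False
  show ?thesis
  proof (cases "0 < x")
    case True
    have "((\<lambda>x. poly P (1 / x) * exp (- (1 / x))) has_real_derivative
        flat ([:0, 0, 1:] * (P - pderiv P)) x) (at x)"
      using True by (auto intro!: derivative_eq_intros poly_DERIV[THEN DERIV_chain2]
        simp: flat_def power2_eq_square field_simps)
    then show ?thesis
      by (rule has_field_derivative_transform_within_open[of _ _ _ "{0<..}"])
        (use True in \<open>auto simp: flat_def\<close>)
  next
    case neg: False
    with False have "x < 0" by simp
    have "((\<lambda>x. 0) has_real_derivative flat ([:0, 0, 1:] * (P - pderiv P)) x) (at x)"
      using \<open>x < 0\<close> by (simp add: flat_def)
    then show ?thesis
      by (rule has_field_derivative_transform_within_open[of _ _ _ "{..<0}"])
        (use \<open>x < 0\<close> in \<open>auto simp: flat_def\<close>)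
  qed
next
  case True
  have "((\<lambda>y. flat P y / y) \<longlongrightarrow> 0) (at_right 0)"
  proof -
    \<comment> \<open>Dividing by the variable multiplies the polynomial in 1/y by one more power,
      which is what \<open>pCons 0\<close> does.\<close>
    have "((\<lambda>y. poly (pCons 0 P) (inverse y) * exp (- inverse y)) \<longlongrightarrow> 0) (at_right (0::real))"
      by (rule filterlim_compose[OF poly_exp_tendsto_0 filterlim_inverse_at_top_right])
    then show ?thesis
      by (rule Lim_transform_eventually)
        (auto simp: eventually_at_filter flat_def field_simps)
  qed
  moreover have "((\<lambda>y. flat P y / y) \<longlongrightarrow> 0) (at_left 0)"
    by (rule Lim_transform_eventually[OF tendsto_const])
        (auto simp: eventually_at_filter flat_def)
  ultimately have "((\<lambda>y. flat P y / y) \<longlongrightarrow> 0) (at 0)"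
    by (simp add: filterlim_split_at_real)
  with True show ?thesis by (simp add: has_field_derivative_iff flat_def)
qed

lemma Cn_flat: "Cn k (flat P)"
proof (induction k arbitrary: P)
  case (Suc k)
  show ?case by (rule Cn_SucI[OF flat_deriv Suc])
qed simp

definition smooth :: "(real \<Rightarrow> real) \<Rightarrow> bool" where "smooth f \<longleftrightarrow> (\<forall>k. Cn k f)"

lemma smooth_deriv:
  assumes "smooth f" shows "smooth (deriv f)" "(f has_real_derivative deriv f x) (at x)"
  using assms Cn_SucD by (auto simp only: smooth_def)

lemma smooth_primitive:
  assumes "\<And>x. (f has_real_derivative f' x) (at x)" "smooth f'" shows "smooth f"
  unfolding smooth_def
proof
  fix k show "Cn k f" using assms(2) by (intro Cn_lower[OF Cn_SucI[OF assms(1)]]) (simp add: smooth_def)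
qed

lemma smooth_continuous: assumes "smooth f" shows "continuous_on UNIV f"
  using smooth_deriv(2)[OF assms] DERIV_isCont by (intro continuous_at_imp_continuous_on) blast

text \<open>Trades the explicit sequence of derivatives for \<open>smooth\<close>. In one direction
  all members of the sequence are shown to be k times differentiable simultaneously, as the
  induction on k moves along the sequence; in the other the iterates of \<open>deriv\<close> are the
  witness.\<close>

lemma test_fun_iff:
  "test_fun \<phi> \<longleftrightarrow> smooth \<phi> \<and> (\<exists>a b. 0 < a \<and> b < 1 \<and> (\<forall>x. x \<notin> {a..b} \<longrightarrow> \<phi> x = 0))"
proof -
  have "(\<exists>ds. ds 0 = \<phi> \<and> (\<forall>k x. (ds k has_real_derivative ds (Suc k) x) (at x))) \<longleftrightarrow> smooth \<phi>"
  proof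
    assume "\<exists>ds. ds 0 = \<phi> \<and> (\<forall>k x. (ds k has_real_derivative ds (Suc k) x) (at x))"
    then obtain ds where ds: "ds 0 = \<phi>" "\<forall>k x. (ds k has_real_derivative ds (Suc k) x) (at x)" by blast
    have "Cn k (ds j)" for k j
      by (induction k arbitrary: j) (use ds in \<open>simp, metis Cn_SucI\<close>)
    then show "smooth \<phi>" unfolding smooth_def ds(1)[symmetric] by blast
  next
    assume "smooth \<phi>"
    then have "smooth ((deriv ^^ k) \<phi>)" for k by (induction k) (auto intro: smooth_deriv)
    then show "\<exists>ds. ds 0 = \<phi> \<and> (\<forall>k x. (ds k has_real_derivative ds (Suc k) x) (at x))"
      using smooth_deriv(2) by (intro exI[of _ "\<lambda>k. (deriv ^^ k) \<phi>"]) auto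
  qed
  then show ?thesis by (simp add: test_fun_def)
qed

lemma test_fun_smooth: "test_fun \<phi> \<Longrightarrow> smooth \<phi>" by (simp add: test_fun_iff)

lemma test_fun_add:
  assumes "test_fun \<phi>" "test_fun \<psi>" shows "test_fun (\<lambda>x. \<phi> x + \<psi> x)"
proof -
  from assms obtain a b a' b' where "0 < a" "b < 1" "\<forall>x. x \<notin> {a..b} \<longrightarrow> \<phi> x = 0"
    "0 < a'" "b' < 1" "\<forall>x. x \<notin> {a'..b'} \<longrightarrow> \<psi> x = 0" unfolding test_fun_iff by blast
  then have "0 < min a a' \<and> max b b' < 1 \<and> (\<forall>x. x \<notin> {min a a'..max b b'} \<longrightarrow> \<phi> x + \<psi> x = 0)"
    by (auto simp: min_le_iff_disj le_max_iff_disj not_le)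
  then show ?thesis using assms unfolding test_fun_iff smooth_def by (blast intro: Cn_add)
qed

lemma test_fun_cmult:
  assumes "test_fun \<phi>" shows "test_fun (\<lambda>x. c * \<phi> x)"
  using assms unfolding test_fun_iff smooth_def by (auto intro!: Cn_mult Cn_const)

lemma test_fun_deriv:
  assumes "test_fun \<phi>"
  shows "smooth (deriv \<phi>)" "L2 \<phi>" "L2 (deriv \<phi>)" "\<phi> 0 = 0" "\<phi> 1 = 0"
    and "x \<in> {0..1} \<Longrightarrow> J (deriv \<phi>) x = \<phi> x"
proof -
  show s: "smooth (deriv \<phi>)" "L2 \<phi>" "L2 (deriv \<phi>)"
    using assms smooth_deriv smooth_continuous test_fun_smooth by (auto intro!: L2_continuous)
  show z: "\<phi> 0 = 0" "\<phi> 1 = 0" using assms by (auto simp: test_fun_iff)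
  show "x \<in> {0..1} \<Longrightarrow> J (deriv \<phi>) x = \<phi> x"
    using J_FTC[of \<phi> "deriv \<phi>" x] smooth_deriv[OF test_fun_smooth[OF assms]]
      smooth_continuous[OF s(1)] z by auto
qed

text \<open>A test function is the primitive of its derivative, whose integral over \<open>D\<close>
  is 0. Hence both the constant c and the boundary term of \<open>J_by_parts\<close>
  disappear.\<close>

lemma weak_deriv_J:
  assumes "L2 g" shows "weak_deriv (\<lambda>x. c + J g x) g"
  unfolding weak_deriv_iff
proof (intro allI impI)
  fix \<phi> assume \<phi>: "test_fun \<phi>"
  note t = test_fun_deriv[OF \<phi>]
  have i0: "(LINT x|M. deriv \<phi> x) = 0" using J_1[of 1 "deriv \<phi>"] t by simp
  have "(LINT x|M. (c + J g x) * deriv \<phi> x) = c * (LINT x|M. deriv \<phi> x) + (LINT x|M. J g x * deriv \<phi> x)"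
    using t(3) J_L2[OF assms] L2_mult[OF J_L2[OF assms] t(3)] unfolding distrib_right mult.assoc
    by (subst Bochner_Integration.integral_add) (auto intro: L2_integrable)
  also have "\<dots> = (LINT s|M. g s * - J (deriv \<phi>) s)"
    using J_by_parts[of g "deriv \<phi>"] t assms by (auto simp: i0)
  also have "\<dots> = (LINT s|M. - (g s * \<phi> s))"
    using t by (intro Bochner_Integration.integral_cong) (auto simp: D_def)
  finally show "(LINT x|M. (c + J g x) * deriv \<phi> x) = - (LINT x|M. g x * \<phi> x)" by simp
qed

section \<open>The fundamental lemma of the calculus of variations\<close>

text \<open>For a smooth \<psi> >= 0 positive exactly on (a, b), the functions 1 - exp (- n \<psi>)
  vanish where \<psi> does, stay in [0, 1] and tend to 1 elsewhere.\<close>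

lemma test_fun_tendsto_indicator:
  assumes "0 < a" "b < 1"
  obtains \<phi> :: "nat \<Rightarrow> real \<Rightarrow> real" where "\<And>n. test_fun (\<phi> n)" "\<And>n x. \<bar>\<phi> n x\<bar> \<le> 1"
    "\<And>x. (\<lambda>n. \<phi> n x) \<longlonglongrightarrow> indicator {a<..<b} x"
proof
  \<comment> \<open>\<open>flat 1\<close> is exp (- 1/x) for positive x and 0 otherwise. The
    products with 1 and -1, here and in \<phi>, give the terms the shape of the closure rules for
    \<open>Cn\<close>.\<close>
  define \<psi> where "\<psi> x = flat 1 (1 * x + (- a)) * flat 1 ((-1) * x + b)" for x
  have pos: "\<psi> x \<ge> 0" for x by (simp add: \<psi>_def flat_def)
  have pos': "\<psi> x > 0" if "x \<in> {a<..<b}" for x using that by (simp add: \<psi>_def flat_def)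
  have zero: "\<psi> x = 0" if "x \<notin> {a<..<b}" for x using that by (auto simp: \<psi>_def flat_def)
  define \<phi> where "\<phi> n x = 1 + (-1) * exp ((- real n) * \<psi> x)" for n x
  have "smooth (\<phi> n)" for n
    unfolding smooth_def \<phi>_def \<psi>_def by (intro allI Cn_add Cn_const Cn_mult Cn_exp Cn_affine Cn_flat)
  then show "test_fun (\<phi> n)" for n
    using assms zero unfolding test_fun_iff \<phi>_def
    by (intro conjI exI[of _ a] exI[of _ b]) auto
  show "\<bar>\<phi> n x\<bar> \<le> 1" for n x
  proof -
    have "(- real n) * \<psi> x \<le> 0" using pos[of x] by simp
    then have "exp ((- real n) * \<psi> x) \<le> 1" by (simp only: exp_le_one_iff)
    then show ?thesis using exp_gt_zero[of "(- real n) * \<psi> x"] by (simp add: \<phi>_def)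
  qed
  show "(\<lambda>n. \<phi> n x) \<longlonglongrightarrow> indicator {a<..<b} x" for x
  proof (cases "x \<in> {a<..<b}")
    case True
    have "filterlim (\<lambda>n. \<psi> x * real n) at_top sequentially"
      by (intro filterlim_tendsto_pos_mult_at_top[OF tendsto_const pos'[OF True]] filterlim_real_sequentially)
    then have "filterlim (\<lambda>n. - (\<psi> x * real n)) at_bot sequentially"
      by (simp add: filterlim_uminus_at_bot)
    then have "(\<lambda>n. exp (- (\<psi> x * real n))) \<longlonglongrightarrow> 0"
      by (rule filterlim_compose[OF exp_at_bot])
    then have "(\<lambda>n. 1 - exp (- (\<psi> x * real n))) \<longlonglongrightarrow> 1 - 0" by (intro tendsto_intros)
    then show ?thesis using True by (simp add: \<phi>_def mult.commute)
  qed (simp add: \<phi>_def zero)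
qed

text \<open>Dominated convergence with majorant |h|, twice: from test functions to intervals
  compactly inside \<open>D\<close>, and from those to arbitrary open intervals.\<close>

lemma fundamental_lemma_interval:
  fixes h :: "real \<Rightarrow> real"
  assumes h: "integrable M h" and 0: "\<And>\<phi>. test_fun \<phi> \<Longrightarrow> (LINT x|M. h x * \<phi> x) = 0"
  shows "(LINT x|M. h x * indicator {a<..<b} x) = 0"
proof -
  note [measurable] = borel_measurable_integrable[OF h]
  have *: "(LINT x|M. h x * indicator {a<..<b} x) = 0" if ab: "0 < a" "b < 1" for a b
  proof -
    obtain \<phi> :: "nat \<Rightarrow> real \<Rightarrow> real" where \<phi>: "\<And>n. test_fun (\<phi> n)" "\<And>n x. \<bar>\<phi> n x\<bar> \<le> 1"
      "\<And>x. (\<lambda>n. \<phi> n x) \<longlonglongrightarrow> indicator {a<..<b} x"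
      using test_fun_tendsto_indicator[OF ab] by blast
    note [measurable] = L2_measurable[OF test_fun_deriv(2)[OF \<phi>(1)]]
    have "(\<lambda>n. LINT x|M. h x * \<phi> n x) \<longlonglongrightarrow> (LINT x|M. h x * indicator {a<..<b} x)"
    proof (rule integral_dominated_convergence[where w = "\<lambda>x. \<bar>h x\<bar>"])
      show "AE x in M. (\<lambda>n. h x * \<phi> n x) \<longlonglongrightarrow> h x * indicator {a<..<b} x"
        using \<phi>(3) by (auto intro!: tendsto_intros)
      show "AE x in M. norm (h x * \<phi> n x) \<le> \<bar>h x\<bar>" for n
        using \<phi>(2) mult_left_mono[of _ 1 "\<bar>h _\<bar>"] by (simp add: abs_mult)
      show "integrable M (\<lambda>x. \<bar>h x\<bar>)" using h by auto
    qed measurable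
    then have "(\<lambda>n. 0) \<longlonglongrightarrow> (LINT x|M. h x * indicator {a<..<b} x)" by (simp add: 0 \<phi>(1))
    then show ?thesis using LIMSEQ_unique tendsto_const by blast
  qed
  \<comment> \<open>These intervals stay away from 0 and 1, so the case just proved applies, and
    they exhaust the part of (a, b) inside \<open>D\<close>.\<close>
  let ?I = "\<lambda>n. {max a (1 / real (n + 2)) <..< min b (1 - 1 / real (n + 2))}"
  have "(\<lambda>n. LINT x|M. h x * indicator (?I n) x) \<longlonglongrightarrow> (LINT x|M. h x * indicator {a<..<b} x)"
  proof (rule integral_dominated_convergence[where w = "\<lambda>x. \<bar>h x\<bar>"])
    have "(\<lambda>n. indicator (?I n) x :: real) \<longlonglongrightarrow> indicator {a<..<b} x" if "x \<in> D" for x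
    proof (rule Lim_transform_eventually[OF tendsto_const])
      have "(\<lambda>n. 1 / real (n + 2)) \<longlonglongrightarrow> 0"
        using LIMSEQ_ignore_initial_segment[OF lim_1_over_n, of 2] by simp
      then have "eventually (\<lambda>n. 1 / real (n + 2) < min x (1 - x)) sequentially"
        by (rule order_tendstoD) (use that in \<open>auto simp: D_def\<close>)
      then show "eventually (\<lambda>n. indicator {a<..<b} x = (indicator (?I n) x :: real)) sequentially"
        by eventually_elim (auto simp: indicator_def)
    qed
    then show "AE x in M. (\<lambda>n. h x * indicator (?I n) x) \<longlonglongrightarrow> h x * indicator {a<..<b} x"
      by (intro AE_I2 tendsto_mult tendsto_const) simp
    show "AE x in M. norm (h x * indicator (?I n) x) \<le> \<bar>h x\<bar>" for n
      by (auto simp: indicator_def)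
    show "integrable M (\<lambda>x. \<bar>h x\<bar>)" using h by auto
  qed measurable
  moreover have "(LINT x|M. h x * indicator (?I n) x) = 0" for n
    by (intro *) (auto simp: less_max_iff_disj min_less_iff_disj)
  ultimately have "(\<lambda>n. 0) \<longlonglongrightarrow> (LINT x|M. h x * indicator {a<..<b} x)" by simp
  then show ?thesis using LIMSEQ_unique tendsto_const by blast
qed

text \<open>A function whose integral over every measurable set vanishes is zero a.e. Open intervals
  are stable under intersection and generate the Borel sets, so Dynkin's argument extends the
  vanishing to Borel sets; a Lebesgue set is Borel up to a null set.\<close>

lemma fundamental_lemma:
  fixes h :: "real \<Rightarrow> real"
  assumes h: "integrable M h" and 0: "\<And>\<phi>. test_fun \<phi> \<Longrightarrow> (LINT x|M. h x * \<phi> x) = 0"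
  shows "AE x in M. h x = 0"
proof (rule M.density_zero[OF h])
  note [measurable] = borel_measurable_integrable[OF h]
  note int = fundamental_lemma_interval[OF h 0]
  \<comment> \<open>Needed for complements in the Dynkin induction; (-1, 2) is just an open interval
    containing \<open>D\<close>.\<close>
  have total: "(LINT x|M. h x) = 0"
  proof -
    have "(LINT x|M. h x) = (LINT x|M. h x * indicator {-1<..<2} x)"
      by (intro Bochner_Integration.integral_cong) (auto simp: D_def)
    then show ?thesis using int by simp
  qed
  have S: "(LINT x|M. h x * indicator B x) = set_lebesgue_integral M (D \<inter> B) h" for B
    unfolding set_lebesgue_integral_def
    by (intro Bochner_Integration.integral_cong) (auto simp: indicator_def)
  have sets: "D \<inter> B \<in> sets M" if "B \<in> sets borel" for B
    using that by (auto simp: sets_restrict_space)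
  have borel: "(LINT x|M. h x * indicator B x) = 0" if "B \<in> sets borel" for B
  proof -
    let ?G = "range (\<lambda>(a, b). {a<..<b::real})"
    have Int: "Int_stable ?G" by (auto simp: Int_stable_def)
    have sub: "?G \<subseteq> Pow UNIV" by simp
    have eq: "sets borel = sigma_sets UNIV ?G"
    proof -
      have box: "(\<lambda>(a, b). box a b) = (\<lambda>(a, b). {a<..<b::real})"
        by (auto simp: fun_eq_iff box_real)
      show ?thesis unfolding borel_eq_box box by (rule sets_measure_of) simp
    qed
    with that have "B \<in> sigma_sets UNIV ?G" by simp
    then show ?thesis
    proof (induction B rule: sigma_sets_induct_disjoint[OF Int sub, consumes 1, case_names basic empty compl union])
      case (union A)
      have meas: "A i \<in> sets borel" for i using union unfolding eq by auto
      have "set_lebesgue_integral M (\<Union>i. D \<inter> A i) h = (\<Sum>i. set_lebesgue_integral M (D \<inter> A i) h)"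
      proof (rule lebesgue_integral_countable_add)
        show "set_integrable M (\<Union>i. D \<inter> A i) h"
          unfolding set_integrable_def using h meas sets
          by (intro integrable_mult_indicator sets.countable_UN) auto
      qed (use union meas sets in \<open>auto simp: disjoint_family_on_def\<close>)
      also have "\<dots> = 0" using union by (simp add: S)
      finally show ?case by (simp only: S Int_UN_distrib)
    next
      case (compl A)
      have [measurable]: "A \<in> sets borel" using compl unfolding eq by auto
      have "(LINT x|M. h x * indicator (UNIV - A) x) = (LINT x|M. h x - h x * indicator A x)"
        by (intro Bochner_Integration.integral_cong) (auto simp: indicator_def)
      also have "\<dots> = 0"
      proof (subst Bochner_Integration.integral_diff[OF h])
        have [measurable]: "(indicator A :: real \<Rightarrow> real) \<in> borel_measurable M"
          by (rule borel_imp_M) measurable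
        show "integrable M (\<lambda>x. h x * indicator A x)"
          by (rule Bochner_Integration.integrable_bound[OF h]) (measurable, auto simp: indicator_def)
      qed (simp add: total compl)
      finally show ?case .
    qed (use int in auto)
  qed
  fix A assume "A \<in> sets M"
  then have "A \<in> sets (completion lborel)" "A \<subseteq> D"
    by (auto simp: sets_restrict_space)
  then obtain S N N' where SN: "A = S \<union> N" "N \<subseteq> N'" "N' \<in> null_sets lborel" "S \<in> sets lborel"
    by (elim sets_completionE)
  have "AE x in lebesgue. x \<notin> N'"
    using SN(3) by (intro AE_completion AE_not_in)
  then have "AE x in M. x \<notin> N'" by (auto simp: AE_restrict_space_iff elim: eventually_mono)
  have [measurable]: "S \<in> sets borel" using SN by simp
  note [measurable] = \<open>A \<in> sets M\<close>
  have "(LINT x|M. indicator A x * h x) = (LINT x|M. h x * indicator S x)"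
  proof (rule integral_cong_AE)
    show "AE x in M. indicator A x * h x = h x * indicator S x"
      using \<open>AE x in M. x \<notin> N'\<close> by eventually_elim (use SN in \<open>auto simp: indicator_def\<close>)
    have [measurable]: "(indicator S :: real \<Rightarrow> real) \<in> borel_measurable M"
      by (rule borel_imp_M) measurable
    show "(\<lambda>x. h x * indicator S x) \<in> borel_measurable M" by measurable
  qed measurable
  then show "set_lebesgue_integral M A h = 0"
    using borel[OF \<open>S \<in> sets borel\<close>] by (simp add: set_lebesgue_integral_def)
qed

lemma continuous_antiderivative:
  assumes "continuous_on UNIV (f :: real \<Rightarrow> real)"
  obtains F where "\<And>x. (F has_real_derivative f x) (at x)"
proof -
  have "\<exists>F. \<forall>x. (-\<infinity> :: ereal) < ereal x \<longrightarrow> ereal x < \<infinity> \<longrightarrow> (F has_vector_derivative f x) (at x)"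
    by (rule einterval_antiderivative) (use assms in \<open>auto simp: continuous_on_eq_continuous_at\<close>)
  then show ?thesis using that by (auto simp: has_real_derivative_iff_has_vector_derivative)
qed

text \<open>The primitive starting at 0 vanishes left of the support of \<psi>; mean value zero is
  exactly what makes it vanish to the right as well.\<close>

lemma test_fun_antiderivative:
  assumes \<psi>: "test_fun \<psi>" and 0: "(LINT x|M. \<psi> x) = 0"
  obtains \<phi> where "test_fun \<phi>" "deriv \<phi> = \<psi>"
proof -
  note cont = smooth_continuous[OF test_fun_smooth[OF \<psi>]]
  obtain F where F: "\<And>x. (F has_real_derivative \<psi> x) (at x)"
    using continuous_antiderivative[OF cont] by blast
  define \<phi> where "\<phi> x = F x - F 0" for x
  have \<phi>: "(\<phi> has_real_derivative \<psi> x) (at x)" for x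
    unfolding \<phi>_def by (rule DERIV_diff[OF F DERIV_const, simplified])
  from \<psi> obtain a b where ab: "0 < a" "b < 1" "\<And>x. x \<notin> {a..b} \<Longrightarrow> \<psi> x = 0"
    unfolding test_fun_iff by blast
  have "J \<psi> 1 = \<phi> 1 - \<phi> 0" using \<phi> cont by (intro J_FTC) auto
  then have one: "\<phi> 1 = 0" using 0 J_1[of 1 \<psi>] by (simp add: \<phi>_def)
  have "\<phi> x = 0" if "x \<notin> {a..b}" for x
  proof (cases "x < a")
    case True
    have "\<phi> x = \<phi> 0"
      \<comment> \<open>An open interval left of the support that contains both x and 0.\<close>
      by (rule DERIV_isconst3[of "min x 0 - 1" a x 0 \<phi>]) (use True ab \<phi> in \<open>auto, metis less_le_not_le\<close>)
    then show ?thesis by (simp add: \<phi>_def)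
  next
    case False
    with that have x: "b < x" by auto
    have "\<phi> x = \<phi> 1"
      by (rule DERIV_isconst3[of b "max x 1 + 1" x 1 \<phi>]) (use x ab \<phi> in \<open>auto, metis less_le_not_le\<close>)
    then show ?thesis using one by simp
  qed
  then have "test_fun \<phi>"
    using smooth_primitive[OF \<phi> test_fun_smooth[OF \<psi>]] ab by (auto simp: test_fun_iff)
  moreover have "deriv \<phi> = \<psi>" using \<phi> by (intro ext DERIV_imp_deriv)
  ultimately show ?thesis by (rule that)
qed

(* With eta a test function of integral 1, psi - (int psi) eta is the derivative of a test
   function, so v - int v eta is orthogonal to every test function psi. *)
lemma weak_deriv_zero_const:
  assumes v: "L2 v" and 0: "\<And>\<phi>. test_fun \<phi> \<Longrightarrow> (LINT x|M. v x * deriv \<phi> x) = 0"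
  shows "\<exists>c. AE x in M. v x = c"
proof -
  \<comment> \<open>Otherwise the constant 1 would be orthogonal to all test functions. The function
    obtained is not normalised, hence the quotients in \<open>c\<close> and
    \<open>k\<close>.\<close>
  have "\<exists>\<eta>. test_fun \<eta> \<and> (LINT x|M. \<eta> x) \<noteq> 0"
  proof (rule ccontr)
    assume "\<not> ?thesis"
    then have "AE x in M. (1::real) = 0" by (intro fundamental_lemma) auto
    then show False using emeasure_M by (simp add: eventually_False ae_filter_eq_bot_iff)
  qed
  then obtain \<eta> where \<eta>: "test_fun \<eta>" "(LINT x|M. \<eta> x) \<noteq> 0" by blast
  note i\<eta> = test_fun_deriv(2)[OF \<eta>(1)]
  define c where "c = (LINT x|M. v x * \<eta> x) / (LINT x|M. \<eta> x)"
  have "AE x in M. v x - c = 0"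
  proof (rule fundamental_lemma)
    show "integrable M (\<lambda>x. v x - c)" using v by auto
    fix \<psi> assume \<psi>: "test_fun \<psi>"
    note i\<psi> = test_fun_deriv(2)[OF \<psi>]
    define k where "k = (LINT x|M. \<psi> x) / (LINT x|M. \<eta> x)"
    have "test_fun (\<lambda>x. \<psi> x + (- k) * \<eta> x)" by (intro test_fun_add test_fun_cmult \<psi> \<eta>)
    moreover have "(LINT x|M. \<psi> x + (- k) * \<eta> x) = 0"
      using i\<eta> i\<psi> \<eta>(2) by (simp add: L2_integrable k_def)
    ultimately obtain \<phi> where \<phi>: "test_fun \<phi>" "deriv \<phi> = (\<lambda>x. \<psi> x + (- k) * \<eta> x)"
      by (rule test_fun_antiderivative)
    have "0 = (LINT x|M. v x * (\<psi> x + (- k) * \<eta> x))" using 0[OF \<phi>(1)] \<phi>(2) by simp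
    also have "\<dots> = (LINT x|M. v x * \<psi> x - k * (v x * \<eta> x))" by (simp add: algebra_simps)
    also have "\<dots> = (LINT x|M. v x * \<psi> x) - k * (LINT x|M. v x * \<eta> x)"
      using L2_mult[OF v i\<psi>] L2_mult[OF v i\<eta>] by simp
    also have "k * (LINT x|M. v x * \<eta> x) = c * (LINT x|M. \<psi> x)" by (simp add: k_def c_def)
    also have "(LINT x|M. v x * \<psi> x) - c * (LINT x|M. \<psi> x) = (LINT x|M. v x * \<psi> x - c * \<psi> x)"
      using L2_mult[OF v i\<psi>] i\<psi> by (simp add: L2_integrable)
    finally show "(LINT x|M. (v x - c) * \<psi> x) = 0" by (simp add: algebra_simps)
  qed
  then show ?thesis by auto
qed

lemma weak_deriv_unique:
  assumes "L2 g" "L2 g'" "weak_deriv u g" "weak_deriv u g'"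
  shows "AE x in M. g x = g' x"
proof -
  have "AE x in M. g x - g' x = 0"
  proof (rule fundamental_lemma)
    show "integrable M (\<lambda>x. g x - g' x)" using assms by auto
    fix \<phi> assume \<phi>: "test_fun \<phi>"
    show "(LINT x|M. (g x - g' x) * \<phi> x) = 0"
      using assms(3,4) \<phi> L2_mult[OF assms(1) test_fun_deriv(2)[OF \<phi>]]
         L2_mult[OF assms(2) test_fun_deriv(2)[OF \<phi>]] by (simp add: weak_deriv_iff left_diff_distrib)
  qed
  then show ?thesis by simp
qed

text \<open>Since \<open>J g\<close> has weak derivative g, the difference u - J g has weak
  derivative 0 and is a.e. constant. All later facts on H1 functions are read off from this
  representation.\<close>

lemma weak_deriv_iff_J:
  assumes u: "L2 u" and g: "L2 g"
  shows "weak_deriv u g \<longleftrightarrow> (\<exists>c. AE x in M. u x = c + J g x)"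
proof
  assume wd: "weak_deriv u g"
  note Jg = J_L2[OF g]
  have "\<exists>c. AE x in M. u x - J g x = c"
  proof (rule weak_deriv_zero_const)
    show "L2 (\<lambda>x. u x - J g x)" using u Jg by auto
    fix \<phi> assume \<phi>: "test_fun \<phi>"
    have "weak_deriv (J g) g" using weak_deriv_J[OF g, of 0] by simp
    then show "(LINT x|M. (u x - J g x) * deriv \<phi> x) = 0"
      using wd \<phi> L2_mult[OF u test_fun_deriv(3)[OF \<phi>]] L2_mult[OF Jg test_fun_deriv(3)[OF \<phi>]]
      by (simp add: weak_deriv_iff left_diff_distrib)
  qed
  then show "\<exists>c. AE x in M. u x = c + J g x"
    by (auto simp: algebra_simps elim!: eventually_mono)
next
  assume "\<exists>c. AE x in M. u x = c + J g x"
  then obtain c where c: "AE x in M. u x = c + J g x" ..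
  note [measurable] = L2_measurable[OF u] L2_measurable[OF g]
  have "(LINT x|M. u x * deriv \<phi> x) = (LINT x|M. (c + J g x) * deriv \<phi> x)" if "test_fun \<phi>" for \<phi>
  proof (rule integral_cong_AE)
    note [measurable] = L2_measurable[OF test_fun_deriv(3)[OF that]]
    show "(\<lambda>x. u x * deriv \<phi> x) \<in> borel_measurable M" by measurable
    show "(\<lambda>x. (c + J g x) * deriv \<phi> x) \<in> borel_measurable M" by measurable
    show "AE x in M. u x * deriv \<phi> x = (c + J g x) * deriv \<phi> x" using c by eventually_elim simp
  qed
  with weak_deriv_J[OF g, of c] show "weak_deriv u g" by (simp add: weak_deriv_iff)
qed

section \<open>Sobolev functions and the fractional integral\<close>

lemma wd_spec: assumes "H1 u" shows "L2 (wd u)" "weak_deriv u (wd u)"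
  using someI_ex[of "\<lambda>g. L2 g \<and> weak_deriv u g"] assms unfolding H1_def wd_def by blast+

lemma H1_L2: "H1 u \<Longrightarrow> L2 u" by (simp add: H1_def)

text \<open>\<open>wd\<close> is a choice among weak derivatives; uniqueness identifies it with a
  concrete candidate, but only almost everywhere.\<close>

lemma wd_AE:
  assumes "L2 u" "L2 g" "weak_deriv u g" shows "H1 u" "AE x in M. wd u x = g x"
proof -
  show "H1 u" using assms by (auto simp: H1_def)
  then show "AE x in M. wd u x = g x" using assms wd_spec weak_deriv_unique by blast
qed

lemma H1E: assumes "H1 u" obtains c where "AE x in M. u x = c + J (wd u) x"
  using weak_deriv_iff_J[OF H1_L2[OF assms] wd_spec(1)[OF assms]] wd_spec(2)[OF assms] by blast

lemma H1I:
  assumes [measurable]: "u \<in> borel_measurable M" and g: "L2 g" and u: "AE x in M. u x = c + J g x"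
  shows "H1 u" "AE x in M. wd u x = g x"
proof -
  have "L2 (\<lambda>x. c + J g x)" using g by auto
  then have "L2 u" using L2_cong_AE[OF _ assms(1) u] by blast
  moreover from this have "weak_deriv u g" using weak_deriv_iff_J[OF _ g] u by blast
  ultimately show "H1 u" "AE x in M. wd u x = g x" using wd_AE g by blast+
qed

lemma H1_lincomb:
  assumes u: "H1 u" and v: "H1 v"
  shows "H1 (\<lambda>x. s * u x + t * v x)" (is "H1 ?w")
    and "AE x in M. wd (\<lambda>x. s * u x + t * v x) x = s * wd u x + t * wd v x"
proof -
  obtain c where c: "AE x in M. u x = c + J (wd u) x" using H1E[OF u] .
  obtain d where d: "AE x in M. v x = d + J (wd v) x" using H1E[OF v] .
  let ?g = "\<lambda>x. s * wd u x + t * wd v x"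
  note L = wd_spec(1)[OF u] wd_spec(1)[OF v]
  have g: "L2 ?g" using L by auto
  have J: "J ?g x = s * J (wd u) x + t * J (wd v) x" for x
    using L by (simp add: J_add J_cmult L2_integrable)
  have "AE x in M. ?w x = (s * c + t * d) + J ?g x"
    using c d by eventually_elim (simp add: J algebra_simps)
  moreover have "?w \<in> borel_measurable M" using H1_L2[OF u] H1_L2[OF v] by (auto dest!: L2_measurable)
  ultimately show "H1 ?w" "AE x in M. wd ?w x = ?g x" using H1I g by blast+
qed

lemma H1_diff:
  assumes u: "H1 u" and v: "H1 v"
  shows "H1 (\<lambda>x. u x - v x)" "AE x in M. wd (\<lambda>x. u x - v x) x = wd u x - wd v x"
  using H1_lincomb[OF u v, of 1 "-1"] by simp_all

lemma H1_cmult: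
  assumes u: "H1 u"
  shows "H1 (\<lambda>x. s * u x)" "AE x in M. wd (\<lambda>x. s * u x) x = s * wd u x"
  using H1_lincomb[OF u u, of s 0] by simp_all

lemma H1_cong_AE:
  assumes v: "H1 v" and u: "u \<in> borel_measurable M" "AE x in M. u x = v x"
  shows "H1 u" "AE x in M. wd u x = wd v x"
proof -
  obtain c where c: "AE x in M. v x = c + J (wd v) x" using H1E[OF v] .
  have "AE x in M. u x = c + J (wd v) x" using c u(2) by eventually_elim simp
  then show "H1 u" "AE x in M. wd u x = wd v x" using H1I[OF u(1) wd_spec(1)[OF v]] by blast+
qed

lemma H1_norm_ge: "l2_norm u \<le> H1_norm u" "l2_norm (wd u) \<le> H1_norm u"
  by (simp_all add: H1_norm_def real_le_rsqrt)

lemma H1_norm_le: "H1_norm u \<le> l2_norm u + l2_norm (wd u)"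
  unfolding H1_norm_def by (rule sqrt_sum_squares_le_sum) auto

lemma H1_norm_nonneg [simp]: "0 \<le> H1_norm u" by (simp add: H1_norm_def)

lemma l2_norm_wd_diff:
  assumes "H1 u" "H1 v"
  shows "l2_norm (wd (\<lambda>x. u x - v x)) = l2_norm (\<lambda>x. wd u x - wd v x)"
  using H1_diff[OF assms] wd_spec(1) assms by (intro l2_norm_cong_AE) auto

section \<open>The space H^1_0: approximation, closedness, zero value at 0\<close>

lemma test_fun_H1:
  assumes "test_fun \<phi>" shows "H1 \<phi>" "AE x in M. wd \<phi> x = deriv \<phi> x"
proof -
  note t = test_fun_deriv[OF assms]
  have "AE x in M. \<phi> x = 0 + J (deriv \<phi>) x" using t(6) D_imp_Icc by (intro AE_DI) auto
  then show "H1 \<phi>" "AE x in M. wd \<phi> x = deriv \<phi> x"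
    using H1I[OF L2_measurable[OF t(2)] t(3)] by blast+
qed

lemma H10_iff:
  "H10 u \<longleftrightarrow> H1 u \<and> (\<exists>\<phi> :: nat \<Rightarrow> real \<Rightarrow> real. (\<forall>n. test_fun (\<phi> n)) \<and>
     (\<lambda>n. l2_norm (\<lambda>x. \<phi> n x - u x)) \<longlonglongrightarrow> 0 \<and>
     (\<lambda>n. l2_norm (\<lambda>x. wd (\<phi> n) x - wd u x)) \<longlonglongrightarrow> 0)"
proof -
  have "(\<lambda>n. H1_norm (\<lambda>x. \<phi> n x - u x)) \<longlonglongrightarrow> 0 \<longleftrightarrow>
     (\<lambda>n. l2_norm (\<lambda>x. \<phi> n x - u x)) \<longlonglongrightarrow> 0 \<and>
     (\<lambda>n. l2_norm (\<lambda>x. wd (\<phi> n) x - wd u x)) \<longlonglongrightarrow> 0"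
    if u: "H1 u" and \<phi>: "\<And>n. test_fun (\<phi> n)" for \<phi> :: "nat \<Rightarrow> real \<Rightarrow> real"
  proof -
    have e: "l2_norm (\<lambda>x. wd (\<phi> n) x - wd u x) = l2_norm (wd (\<lambda>x. \<phi> n x - u x))" for n
      using l2_norm_wd_diff[OF test_fun_H1(1)[OF \<phi>] u] by simp
    show ?thesis unfolding e
    proof safe
      assume *: "(\<lambda>n. H1_norm (\<lambda>x. \<phi> n x - u x)) \<longlonglongrightarrow> 0"
      show "(\<lambda>n. l2_norm (\<lambda>x. \<phi> n x - u x)) \<longlonglongrightarrow> 0"
        by (rule tendsto_sandwich[OF _ _ tendsto_const *]) (auto simp: H1_norm_ge)
      show "(\<lambda>n. l2_norm (wd (\<lambda>x. \<phi> n x - u x))) \<longlonglongrightarrow> 0"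
        by (rule tendsto_sandwich[OF _ _ tendsto_const *]) (auto simp: H1_norm_ge)
    next
      assume "(\<lambda>n. l2_norm (\<lambda>x. \<phi> n x - u x)) \<longlonglongrightarrow> 0"
        "(\<lambda>n. l2_norm (wd (\<lambda>x. \<phi> n x - u x))) \<longlonglongrightarrow> 0"
      from tendsto_add[OF this] have *: "(\<lambda>n. l2_norm (\<lambda>x. \<phi> n x - u x) + l2_norm (wd (\<lambda>x. \<phi> n x - u x))) \<longlonglongrightarrow> 0"
        by simp
      show "(\<lambda>n. H1_norm (\<lambda>x. \<phi> n x - u x)) \<longlonglongrightarrow> 0"
        by (rule tendsto_sandwich[OF _ _ tendsto_const *]) (auto simp: H1_norm_le)
    qed
  qed
  then show ?thesis unfolding H10_def by blast
qed

lemma H10_H1: "H10 u \<Longrightarrow> H1 u" by (simp add: H10_def)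

lemma test_fun_H10: assumes "test_fun \<phi>" shows "H10 \<phi>"
  using assms test_fun_H1[OF assms] by (auto simp: H10_iff intro!: exI[of _ "\<lambda>n. \<phi>"])

lemma H10_cmult: assumes "H10 u" shows "H10 (\<lambda>x. c * u x)"
proof -
  from assms obtain \<phi> where u: "H1 u" and \<phi>: "\<And>n. test_fun (\<phi> n)"
    and 1: "(\<lambda>n. l2_norm (\<lambda>x. \<phi> n x - u x)) \<longlonglongrightarrow> 0"
    and 2: "(\<lambda>n. l2_norm (\<lambda>x. wd (\<phi> n) x - wd u x)) \<longlonglongrightarrow> 0"
    unfolding H10_iff by blast
  have "l2_norm (\<lambda>x. c * \<phi> n x - c * u x) = \<bar>c\<bar> * l2_norm (\<lambda>x. \<phi> n x - u x)" for n
    unfolding l2_norm_cmult[symmetric] by (simp add: algebra_simps)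
  moreover have "l2_norm (\<lambda>x. wd (\<lambda>x. c * \<phi> n x) x - wd (\<lambda>x. c * u x) x) =
    \<bar>c\<bar> * l2_norm (\<lambda>x. wd (\<phi> n) x - wd u x)" for n
  proof -
    note h = test_fun_H1(1)[OF \<phi>, of n]
    have "l2_norm (\<lambda>x. wd (\<lambda>x. c * \<phi> n x) x - wd (\<lambda>x. c * u x) x) =
        l2_norm (\<lambda>x. c * (wd (\<phi> n) x - wd u x))"
    proof (rule l2_norm_cong_AE)
      show "L2 (\<lambda>x. wd (\<lambda>x. c * \<phi> n x) x - wd (\<lambda>x. c * u x) x)"
        using wd_spec(1)[OF H1_cmult(1)[OF h]] wd_spec(1)[OF H1_cmult(1)[OF u]] by blast
      show "L2 (\<lambda>x. c * (wd (\<phi> n) x - wd u x))"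
        by (rule L2_cmult[OF L2_diff[OF wd_spec(1)[OF h] wd_spec(1)[OF u]]])
      show "AE x in M. wd (\<lambda>x. c * \<phi> n x) x - wd (\<lambda>x. c * u x) x = c * (wd (\<phi> n) x - wd u x)"
        using H1_cmult(2)[OF h, of c] H1_cmult(2)[OF u, of c]
        by eventually_elim (simp add: algebra_simps)
    qed
    then show ?thesis by (simp add: l2_norm_cmult)
  qed
  ultimately show ?thesis
    unfolding H10_iff using H1_cmult(1)[OF u] test_fun_cmult[OF \<phi>] tendsto_mult_right_zero[OF 1] tendsto_mult_right_zero[OF 2]
    by (intro conjI exI[of _ "\<lambda>n x. c * \<phi> n x"]) auto
qed

text \<open>Diagonal choice: each \<open>W n\<close> is replaced by a test function within 1/(n+1)
  of it in both norms, and the triangle inequality does the rest.\<close>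

lemma H10_closed:
  assumes w: "H1 w" and h: "\<And>n. H10 (W n)"
    and 1: "(\<lambda>n. l2_norm (\<lambda>x. W n x - w x)) \<longlonglongrightarrow> 0"
    and 2: "(\<lambda>n. l2_norm (\<lambda>x. wd (W n) x - wd w x)) \<longlonglongrightarrow> 0"
  shows "H10 w"
proof -
  have "\<exists>\<phi>. test_fun \<phi> \<and> l2_norm (\<lambda>x. \<phi> x - W n x) < 1 / real (Suc n) \<and>
      l2_norm (\<lambda>x. wd \<phi> x - wd (W n) x) < 1 / real (Suc n)" for n
  proof -
    from h[of n] obtain \<phi> where \<phi>: "\<And>k. test_fun (\<phi> k)"
      and 1: "(\<lambda>k. l2_norm (\<lambda>x. \<phi> k x - W n x)) \<longlonglongrightarrow> 0"
      and 2: "(\<lambda>k. l2_norm (\<lambda>x. wd (\<phi> k) x - wd (W n) x)) \<longlonglongrightarrow> 0"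
      unfolding H10_iff by blast
    have "\<forall>\<^sub>F k in sequentially. l2_norm (\<lambda>x. \<phi> k x - W n x) < 1 / real (Suc n)"
      "\<forall>\<^sub>F k in sequentially. l2_norm (\<lambda>x. wd (\<phi> k) x - wd (W n) x) < 1 / real (Suc n)"
      using order_tendstoD(2)[OF 1, of "1 / real (Suc n)"] order_tendstoD(2)[OF 2, of "1 / real (Suc n)"] by simp_all
    then have "\<forall>\<^sub>F k in sequentially. l2_norm (\<lambda>x. \<phi> k x - W n x) < 1 / real (Suc n) \<and>
      l2_norm (\<lambda>x. wd (\<phi> k) x - wd (W n) x) < 1 / real (Suc n)" by (rule eventually_conj)
    then obtain k where "l2_norm (\<lambda>x. \<phi> k x - W n x) < 1 / real (Suc n) \<and>
      l2_norm (\<lambda>x. wd (\<phi> k) x - wd (W n) x) < 1 / real (Suc n)"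
      by (auto simp: eventually_sequentially)
    with \<phi> show ?thesis by blast
  qed
  then obtain \<phi> where \<phi>: "\<And>n. test_fun (\<phi> n)"
    and \<phi>1: "\<And>n. l2_norm (\<lambda>x. \<phi> n x - W n x) < 1 / real (Suc n)"
    and \<phi>2: "\<And>n. l2_norm (\<lambda>x. wd (\<phi> n) x - wd (W n) x) < 1 / real (Suc n)"
    by metis
  have lim: "(\<lambda>n. 1 / real (Suc n)) \<longlonglongrightarrow> 0"
    using LIMSEQ_Suc[OF lim_1_over_n] by simp
  have tri: "l2_norm (\<lambda>x. a x - c x) \<le> l2_norm (\<lambda>x. a x - b x) + l2_norm (\<lambda>x. b x - c x)"
    if "L2 a" "L2 b" "L2 c" for a b c
    using l2_norm_triangle[OF L2_diff[OF that(1,2)] L2_diff[OF that(2,3)]] by simp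
  note L = wd_spec(1)[OF test_fun_H1(1)[OF \<phi>]] wd_spec(1)[OF H10_H1[OF h]] wd_spec(1)[OF w]
    test_fun_deriv(2)[OF \<phi>] H1_L2[OF H10_H1[OF h]] H1_L2[OF w]
  have "l2_norm (\<lambda>x. \<phi> n x - w x) \<le> 1 / real (Suc n) + l2_norm (\<lambda>x. W n x - w x)" for n
    using tri[OF L(4,5,6), of n n] \<phi>1[of n] by linarith
  moreover have "l2_norm (\<lambda>x. wd (\<phi> n) x - wd w x) \<le> 1 / real (Suc n) + l2_norm (\<lambda>x. wd (W n) x - wd w x)" for n
    using tri[OF L(1,2,3), of n n] \<phi>2[of n] by linarith
  moreover have "(\<lambda>n. 1 / real (Suc n) + l2_norm (\<lambda>x. W n x - w x)) \<longlonglongrightarrow> 0"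
    using tendsto_add[OF lim 1] by simp
  moreover have "(\<lambda>n. 1 / real (Suc n) + l2_norm (\<lambda>x. wd (W n) x - wd w x)) \<longlonglongrightarrow> 0"
    using tendsto_add[OF lim 2] by simp
  ultimately have "(\<lambda>n. l2_norm (\<lambda>x. \<phi> n x - w x)) \<longlonglongrightarrow> 0"
    "(\<lambda>n. l2_norm (\<lambda>x. wd (\<phi> n) x - wd w x)) \<longlonglongrightarrow> 0"
    by - (rule tendsto_sandwich[OF always_eventually always_eventually tendsto_const], simp, rule allI, assumption, assumption)+
  then show ?thesis unfolding H10_iff using w \<phi> by blast
qed

text \<open>Test functions are primitives with constant 0, so the constant c in w = c + J w' is
  bounded by the distance of w to any of them, and that distance can be made arbitrarily
  small.\<close>

lemma H10_eq_J:
  assumes "H10 w" shows "AE x in M. w x = J (wd w) x"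
proof -
  from assms obtain \<phi> where w: "H1 w" and \<phi>: "\<And>n. test_fun (\<phi> n)"
    and 1: "(\<lambda>n. l2_norm (\<lambda>x. \<phi> n x - w x)) \<longlonglongrightarrow> 0"
    and 2: "(\<lambda>n. l2_norm (\<lambda>x. wd (\<phi> n) x - wd w x)) \<longlonglongrightarrow> 0"
    unfolding H10_iff by blast
  obtain c where c: "AE x in M. w x = c + J (wd w) x" using H1E[OF w] .
  have "\<bar>c\<bar> \<le> l2_norm (\<lambda>x. wd (\<phi> n) x - wd w x) + l2_norm (\<lambda>x. \<phi> n x - w x)" for n
  proof -
    note t = test_fun_deriv[OF \<phi>[of n]] and h = test_fun_H1[OF \<phi>[of n]]
    let ?g = "\<lambda>x. wd (\<phi> n) x - wd w x" and ?d = "\<lambda>x. \<phi> n x - w x"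
    have g: "L2 ?g" and d: "L2 ?d" using wd_spec(1)[OF h(1)] wd_spec(1)[OF w] t(2) H1_L2[OF w] by blast+
    have D: "AE x in M. x \<in> {0..1}" by (rule AE_DI[OF D_imp_Icc])
    \<comment> \<open>The test function cancels: (\<phi> - J w') - (\<phi> - w) = w - J w'.\<close>
    have "AE x in M. J ?g x - ?d x = c"
      using c D
    proof eventually_elim
      case (elim x)
      have "J ?g x = J (wd (\<phi> n)) x - J (wd w) x"
        using wd_spec(1)[OF h(1)] wd_spec(1)[OF w] by (intro J_diff) auto
      also have "J (wd (\<phi> n)) x = J (deriv (\<phi> n)) x"
        using wd_spec(1)[OF h(1)] t(3) h(2) by (intro J_cong_AE) auto
      finally show ?case using elim t(6) by simp
    qed
    then have "\<bar>c\<bar> = l2_norm (\<lambda>x. J ?g x - ?d x)"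
      using l2_norm_cong_AE[OF L2_diff[OF J_L2[OF g] d] L2_const[of c]] by simp
    also have "\<dots> \<le> l2_norm ?g + l2_norm ?d"
      using l2_norm_triangle_diff[OF J_L2[OF g] d] J_norm[OF g] by simp
    finally show ?thesis .
  qed
  then have "\<bar>c\<bar> \<le> 0"
    using tendsto_lowerbound[OF tendsto_add[OF 2 1], of "\<bar>c\<bar>"] by simp
  with c show ?thesis by simp
qed

section \<open>Integrals of power kernels\<close>

text \<open>Only F has to be continuous up to the endpoints, so f may be singular there.
  Nonnegativity upgrades gauge integrability to Lebesgue integrability.\<close>

lemma kernel_integral:
  fixes f F :: "real \<Rightarrow> real"
  assumes s: "0 \<le> s" "s \<le> x" "x \<le> 1" and nonneg: "\<And>t. s < t \<Longrightarrow> t < x \<Longrightarrow> 0 \<le> f t"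
    and F: "continuous_on {s..x} F" "\<And>t. s < t \<Longrightarrow> t < x \<Longrightarrow> (F has_real_derivative f t) (at t)"
  shows "integrable M (\<lambda>t. if s < t \<and> t < x then f t else 0)"
    "(LINT t|M. (if s < t \<and> t < x then f t else 0)) = F x - F s"
proof -
  let ?g = "\<lambda>t. if s < t \<and> t < x then f t else 0"
  have "(f has_integral (F x - F s)) {s..x}"
    using s F by (intro fundamental_theorem_of_calculus_interior)
      (auto simp: has_real_derivative_iff_has_vector_derivative[symmetric])
  then have "((\<lambda>t. if t \<in> {s..x} then f t else 0) has_integral (F x - F s)) UNIV"
    by (simp only: has_integral_restrict_UNIV)
  then have "((\<lambda>t. if t \<in> D then ?g t else 0) has_integral (F x - F s)) UNIV"
    by (rule has_integral_spike_finite[where S = "{s, x}", rotated 2]) (use s in \<open>auto simp: D_def\<close>)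
  then have g: "(?g has_integral (F x - F s)) D"
    by (simp only: has_integral_restrict_UNIV)
  have "?g absolutely_integrable_on D"
    using g nonneg by (intro nonnegative_absolutely_integrable_1) auto
  then show i: "integrable M ?g" by (simp add: set_integrable_D)
  show "(LINT t|M. ?g t) = F x - F s"
    using has_integral_unique[OF has_integral_integral_lebesgue_on[OF i D_sets] g] .
qed

lemma DERIV_powr_primitive:
  fixes b z :: real
  assumes "-1 < b" "0 < z"
  shows "((\<lambda>z. z powr (b + 1) / (b + 1)) has_real_derivative z powr b) (at z)"
  using DERIV_cdivide[OF has_real_derivative_powr[OF assms(2), of "b + 1"], of "b + 1"] assms by simp

lemma powr_kernel_left:
  fixes b :: real
  assumes s: "0 \<le> s" "s \<le> x" "x \<le> 1" and b: "-1 < b"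
  shows "integrable M (\<lambda>t. if s < t \<and> t < x then (x - t) powr b else 0)"
    "(LINT t|M. (if s < t \<and> t < x then (x - t) powr b else 0)) = (x - s) powr (b + 1) / (b + 1)"
proof -
  let ?F = "\<lambda>t. - ((x - t) powr (b + 1) / (b + 1))"
  have F: "continuous_on {s..x} ?F"
    using b by (intro continuous_intros continuous_on_powr') auto
  have d: "(?F has_real_derivative (x - t) powr b) (at t)" if "s < t" "t < x" for t
  proof -
    have "((\<lambda>t. x - t) has_real_derivative -1) (at t)" by (auto intro!: derivative_eq_intros)
    from DERIV_minus[OF DERIV_chain2[OF DERIV_powr_primitive[OF b] this]] that show ?thesis by simp
  qed
  show "integrable M (\<lambda>t. if s < t \<and> t < x then (x - t) powr b else 0)"
    "(LINT t|M. (if s < t \<and> t < x then (x - t) powr b else 0)) = (x - s) powr (b + 1) / (b + 1)"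
    using kernel_integral[OF s _ F d] b by simp_all
qed

text \<open>The singularity is now at s, yet the value equals that of
  \<open>powr_kernel_left\<close>. This reflection symmetry is what allows the fractional integral
  and \<open>J\<close> to commute.\<close>

lemma powr_kernel_right:
  fixes b :: real
  assumes s: "0 \<le> s" "s \<le> x" "x \<le> 1" and b: "-1 < b"
  shows "integrable M (\<lambda>t. if s < t \<and> t < x then (t - s) powr b else 0)"
    "(LINT t|M. (if s < t \<and> t < x then (t - s) powr b else 0)) = (x - s) powr (b + 1) / (b + 1)"
proof -
  let ?F = "\<lambda>t. ((t - s) powr (b + 1) / (b + 1))"
  have F: "continuous_on {s..x} ?F"
    using b by (intro continuous_intros continuous_on_powr') auto
  have d: "(?F has_real_derivative (t - s) powr b) (at t)" if "s < t" "t < x" for t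
  proof -
    have "((\<lambda>t. t - s) has_real_derivative 1) (at t)" by (auto intro!: derivative_eq_intros)
    from DERIV_chain2[OF DERIV_powr_primitive[OF b] this] that show ?thesis by simp
  qed
  show "integrable M (\<lambda>t. if s < t \<and> t < x then (t - s) powr b else 0)"
    "(LINT t|M. (if s < t \<and> t < x then (t - s) powr b else 0)) = (x - s) powr (b + 1) / (b + 1)"
    using kernel_integral[OF s _ F d] b by simp_all
qed

section \<open>The fractional integral of order alpha - 1 on L2\<close>

text \<open>\<open>RL\<close> as an operator on the derivative u = w', with the cut-off inside the
  integral over \<open>D\<close> as in \<open>J\<close>.\<close>

definition fracI :: "real \<Rightarrow> (real \<Rightarrow> real) \<Rightarrow> real \<Rightarrow> real" where
  "fracI \<alpha> u x = (1 / Gamma (\<alpha> - 1)) * (LINT t|M. (if t < x then (x - t) powr (\<alpha> - 2) * u t else 0))"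

lemma RL_eq_fracI: assumes "x \<in> {0..1}" shows "RL \<alpha> w x = fracI \<alpha> (wd w) x"
proof -
  have "(LINT t:{0<..<x}|lebesgue. (x - t) powr (\<alpha> - 2) * wd w t) =
    (LINT t:D|lebesgue. (if t < x then (x - t) powr (\<alpha> - 2) * wd w t else 0))"
    unfolding set_lebesgue_integral_def using assms
    by (intro Bochner_Integration.integral_cong) (auto simp: D_def indicator_def)
  then show ?thesis by (simp add: RL_def fracI_def set_integral_D)
qed

lemma fracI_measurable [measurable]:
  assumes [measurable]: "u \<in> borel_measurable M" shows "fracI \<alpha> u \<in> borel_measurable M"
  unfolding fracI_def by measurable

lemma fracI_cmult: "fracI \<alpha> (\<lambda>t. c * u t) x = c * fracI \<alpha> u x"
proof -
  have "(LINT t|M. (if t < x then (x - t) powr (\<alpha> - 2) * (c * u t) else 0)) =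
    (LINT t|M. c * (if t < x then (x - t) powr (\<alpha> - 2) * u t else 0))"
    by (intro Bochner_Integration.integral_cong) auto
  then show ?thesis by (simp add: fracI_def)
qed

text \<open>The square root bounds the L2 norm of the kernel: the integral of (x - t)^(2 alpha - 4)
  over (0, x) is x^(2 alpha - 3) / (2 alpha - 3).\<close>

definition fracI_bound :: "real \<Rightarrow> real" where
  "fracI_bound \<alpha> = 1 / Gamma (\<alpha> - 1) * sqrt (1 / (2 * \<alpha> - 3))"

context
  fixes \<alpha> :: real
  assumes \<alpha>: "3/2 < \<alpha>" "\<alpha> < 2"
begin

lemma Gamma_pos: "0 < Gamma (\<alpha> - 1)" using \<alpha> by (intro Gamma_real_pos) simp

lemma fracI_bound_nonneg: "0 \<le> fracI_bound \<alpha>" using \<alpha> Gamma_pos by (simp add: fracI_bound_def)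

text \<open>Squaring gives the exponent 2 alpha - 4, which exceeds -1 because alpha > 3/2. Writing
  \<open>fracI\<close> as an inner product with an L2 kernel makes Cauchy-Schwarz available at each
  point.\<close>

lemma fracI_kernel:
  assumes x: "x \<in> {0..1}"
  shows "L2 (\<lambda>t. if t < x then (x - t) powr (\<alpha> - 2) else 0)" (is "L2 ?k")
    "l2_norm (\<lambda>t. if t < x then (x - t) powr (\<alpha> - 2) else 0) \<le> sqrt (1 / (2 * \<alpha> - 3))"
    "l2_inner (\<lambda>t. if t < x then (x - t) powr (\<alpha> - 2) else 0) u / Gamma (\<alpha> - 1) = fracI \<alpha> u x"
proof -
  let ?k2 = "\<lambda>t. if 0 < t \<and> t < x then (x - t) powr (2 * \<alpha> - 4) else 0"
  have i: "integrable M ?k2" "(LINT t|M. ?k2 t) = x powr (2 * \<alpha> - 3) / (2 * \<alpha> - 3)"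
    using powr_kernel_left[of 0 x "2 * \<alpha> - 4"] x \<alpha> by auto
  have e: "(?k t)\<^sup>2 = ?k2 t" if "t \<in> space M" for t
    using that by (auto simp: D_def power2_eq_square powr_add[symmetric])
  have "integrable M (\<lambda>t. (?k t)\<^sup>2)"
    using Bochner_Integration.integrable_cong[of M M "\<lambda>t. (?k t)\<^sup>2" ?k2, OF refl e] i(1) by simp
  moreover have "?k \<in> borel_measurable M" by measurable
  ultimately show "L2 ?k" by (simp add: L2_iff)
  have "(LINT t|M. (?k t)\<^sup>2) = x powr (2 * \<alpha> - 3) / (2 * \<alpha> - 3)"
    using Bochner_Integration.integral_cong[of M M "\<lambda>t. (?k t)\<^sup>2" ?k2, OF refl e] i(2) by simp
  also have "\<dots> \<le> 1 / (2 * \<alpha> - 3)"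
    using x \<alpha> by (intro divide_right_mono) (auto intro: powr_le1)
  finally show "l2_norm ?k \<le> sqrt (1 / (2 * \<alpha> - 3))"
    unfolding l2_norm_eq by (rule real_sqrt_le_mono)
  have "l2_inner ?k u = (LINT t|M. (if t < x then (x - t) powr (\<alpha> - 2) * u t else 0))"
    unfolding l2_inner_eq by (intro Bochner_Integration.integral_cong) auto
  then show "l2_inner ?k u / Gamma (\<alpha> - 1) = fracI \<alpha> u x" by (simp add: fracI_def)
qed

text \<open>The bound holds at every point and not merely a.e., which is essential for the nonlocal
  coefficient, the value at 1.\<close>

lemma fracI_le:
  assumes u: "L2 u" and x: "x \<in> {0..1}" shows "\<bar>fracI \<alpha> u x\<bar> \<le> fracI_bound \<alpha> * l2_norm u"
proof -
  let ?k = "\<lambda>t. if t < x then (x - t) powr (\<alpha> - 2) else 0"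
  have "\<bar>l2_inner ?k u\<bar> \<le> l2_norm ?k * l2_norm u"
    by (rule l2_Cauchy_Schwarz[OF fracI_kernel(1)[OF x] u])
  also have "\<dots> \<le> sqrt (1 / (2 * \<alpha> - 3)) * l2_norm u"
    by (intro mult_right_mono fracI_kernel(2)[OF x]) simp
  finally have "\<bar>l2_inner ?k u\<bar> / Gamma (\<alpha> - 1) \<le> sqrt (1 / (2 * \<alpha> - 3)) * l2_norm u / Gamma (\<alpha> - 1)"
    using Gamma_pos by (intro divide_right_mono) auto
  moreover have "\<bar>fracI \<alpha> u x\<bar> = \<bar>l2_inner ?k u\<bar> / Gamma (\<alpha> - 1)"
    using Gamma_pos unfolding fracI_kernel(3)[OF x, symmetric] by (simp add: abs_divide)
  ultimately show ?thesis by (simp add: fracI_bound_def)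
qed

lemma fracI_add_diff:
  assumes u: "L2 u" and v: "L2 v" and x: "x \<in> {0..1}"
  shows "fracI \<alpha> (\<lambda>t. u t + v t) x = fracI \<alpha> u x + fracI \<alpha> v x" "fracI \<alpha> (\<lambda>t. u t - v t) x = fracI \<alpha> u x - fracI \<alpha> v x"
proof -
  note L = L2_mult[OF fracI_kernel(1)[OF x] u] L2_mult[OF fracI_kernel(1)[OF x] v]
  show "fracI \<alpha> (\<lambda>t. u t + v t) x = fracI \<alpha> u x + fracI \<alpha> v x"
    unfolding fracI_kernel(3)[OF x, symmetric] add_divide_distrib[symmetric] l2_inner_eq distrib_left
    using L by (subst Bochner_Integration.integral_add) auto
  show "fracI \<alpha> (\<lambda>t. u t - v t) x = fracI \<alpha> u x - fracI \<alpha> v x"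
    unfolding fracI_kernel(3)[OF x, symmetric] diff_divide_distrib[symmetric] l2_inner_eq right_diff_distrib
    using L by (subst Bochner_Integration.integral_diff) auto
qed

lemma fracI_L2: assumes u: "L2 u" shows "L2 (fracI \<alpha> u)" "l2_norm (fracI \<alpha> u) \<le> fracI_bound \<alpha> * l2_norm u"
proof -
  have m: "fracI \<alpha> u \<in> borel_measurable M" using u by measurable
  have b: "AE x in M. \<bar>fracI \<alpha> u x\<bar> \<le> fracI_bound \<alpha> * l2_norm u"
    using fracI_le[OF u D_imp_Icc] by (rule AE_DI)
  show "L2 (fracI \<alpha> u)" by (rule L2_bounded[OF m b])
  show "l2_norm (fracI \<alpha> u) \<le> fracI_bound \<alpha> * l2_norm u"
    using fracI_bound_nonneg by (intro l2_norm_bounded[OF m b]) simp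
qed

(* Fubini: both sides integrate g s (x - s)^(alpha-1) / Gamma(alpha) over s < x. *)
lemma fracI_J:
  assumes g: "L2 g" and x: "x \<in> {0..1}" shows "fracI \<alpha> (J g) x = J (fracI \<alpha> g) x"
proof -
  let ?b = "\<alpha> - 2"
  have b: "-1 < ?b" using \<alpha> by simp
  note [measurable] = L2_measurable[OF g]
  \<comment> \<open>Both integrals equal (x - s)^(alpha - 1) / (alpha - 1), or 0 when s > x.\<close>
  have K: "(LINT t|M. (if s < t \<and> t < x then (x - t) powr ?b else 0)) =
      (LINT y|M. (if s < y \<and> y < x then (y - s) powr ?b else 0))" if s: "s \<in> D" for s
  proof (cases "s \<le> x")
    case True
    then show ?thesis
      using powr_kernel_left(2)[of s x ?b] powr_kernel_right(2)[of s x ?b] b x s by (simp add: D_def)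
  next
    case False
    then have "(if s < t \<and> t < x then a else 0) = 0" for t and a :: real by auto
    then show ?thesis by (simp only:)
  qed
  have "(LINT t|M. (if t < x then (x - t) powr ?b * J g t else 0)) =
      (LINT t|M. LINT s|M. g s * (if s < t \<and> t < x then (x - t) powr ?b else 0))"
    unfolding J_def by (intro Bochner_Integration.integral_cong)
      (auto simp flip: integral_mult_right_zero intro!: Bochner_Integration.integral_cong)
  also have "\<dots> = (LINT s|M. LINT t|M. g s * (if s < t \<and> t < x then (x - t) powr ?b else 0))"
  proof (rule MM.Fubini_integral)
    have k: "integrable M (\<lambda>t. if t < x then (x - t) powr ?b else 0)"
      using fracI_kernel(1)[OF x] by auto
    show "integrable (M \<Otimes>\<^sub>M M) (\<lambda>(s, t). g s * (if s < t \<and> t < x then (x - t) powr ?b else 0))"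
      by (rule Bochner_Integration.integrable_bound[OF integrable_MM_mult[OF L2_integrable[OF g] k]]) auto
  qed
  also have "\<dots> = (LINT s|M. LINT y|M. g s * (if s < y \<and> y < x then (y - s) powr ?b else 0))"
    unfolding integral_mult_right_zero by (intro Bochner_Integration.integral_cong refl) (simp add: K)
  also have "\<dots> = (LINT y|M. LINT s|M. g s * (if s < y \<and> y < x then (y - s) powr ?b else 0))"
  proof (rule MM.Fubini_integral[symmetric])
    show "integrable (M \<Otimes>\<^sub>M M) (\<lambda>(s, y). g s * (if s < y \<and> y < x then (y - s) powr ?b else 0))"
    \<comment> \<open>In the first exchange the integrand was dominated by a product of a function
      of s and one of t. Here the singularity lies on the diagonal, so the iterated integral of the
      absolute value is bounded instead.\<close>
    proof (rule MM.Fubini_integrable)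
      show "(\<lambda>(s, y). g s * (if s < y \<and> y < x then (y - s) powr ?b else 0)) \<in> borel_measurable (M \<Otimes>\<^sub>M M)"
        by measurable
      have *: "integrable M (\<lambda>y. if s < y \<and> y < x then (y - s) powr ?b else 0)" if "s \<in> D" for s
      proof (cases "s \<le> x")
        case True
        then show ?thesis using powr_kernel_right(1)[of s x ?b] b x that by (simp add: D_def)
      next
        case False
        then have "(if s < t \<and> t < x then a else 0) = 0" for t and a :: real by auto
        then show ?thesis by (simp only:) simp
      qed
      then show "AE s in M. integrable M (\<lambda>y. case (s, y) of (s, y) \<Rightarrow> g s * (if s < y \<and> y < x then (y - s) powr ?b else 0))"
        by (intro AE_DI) auto
      let ?f = "\<lambda>s. LINT y|M. norm (case (s, y) of (s, y) \<Rightarrow> g s * (if s < y \<and> y < x then (y - s) powr ?b else 0))"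
      show "integrable M ?f"
      proof (rule Bochner_Integration.integrable_bound)
        show "integrable M (\<lambda>s. \<bar>g s\<bar> * (1 / (\<alpha> - 1)))"
          by (rule integrable_mult_left[OF integrable_abs[OF L2_integrable[OF g]]])
        show "?f \<in> borel_measurable M" by measurable
        show "AE s in M. norm (?f s) \<le> norm (\<bar>g s\<bar> * (1 / (\<alpha> - 1)))"
        proof (rule AE_DI)
          fix s assume s: "s \<in> D"
          have "?f s = \<bar>g s\<bar> * (LINT y|M. (if s < y \<and> y < x then (y - s) powr ?b else 0))"
            by (simp add: abs_mult if_distrib[of abs] cong: if_cong)
          also have "(LINT y|M. (if s < y \<and> y < x then (y - s) powr ?b else 0)) \<le> 1 / (\<alpha> - 1)"
          proof (cases "s \<le> x")
            case True
            then have "(LINT y|M. (if s < y \<and> y < x then (y - s) powr ?b else 0)) = (x - s) powr (\<alpha> - 1) / (\<alpha> - 1)"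
              using powr_kernel_right(2)[of s x ?b] b x s by (simp add: D_def)
            also have "\<dots> \<le> 1 / (\<alpha> - 1)"
              using \<alpha> True s x by (intro divide_right_mono) (auto simp: D_def intro: powr_le1)
            finally show ?thesis .
          next
            case False
            then have "(if s < t \<and> t < x then a else 0) = 0" for t and a :: real by auto
            then have "(LINT y|M. (if s < y \<and> y < x then (y - s) powr ?b else 0)) = 0" by (simp only:) simp
            then show ?thesis using \<alpha> by simp
          qed
          finally have "?f s \<le> \<bar>g s\<bar> * (1 / (\<alpha> - 1))" by (simp add: mult_left_mono)
          moreover have "0 \<le> ?f s" by (intro integral_nonneg_AE) simp
          ultimately show "norm (?f s) \<le> norm (\<bar>g s\<bar> * (1 / (\<alpha> - 1)))" using \<alpha> by simp
        qed
      qed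
    qed
  qed
  also have "\<dots> = (LINT y|M. (if y < x then LINT s|M. (if s < y then (y - s) powr ?b * g s else 0) else 0))"
    by (intro Bochner_Integration.integral_cong) (auto intro!: Bochner_Integration.integral_cong)
  finally have *: "(LINT t|M. (if t < x then (x - t) powr ?b * J g t else 0)) =
     (LINT y|M. (if y < x then LINT s|M. (if s < y then (y - s) powr ?b * g s else 0) else 0))" .
  have "fracI \<alpha> (J g) x = 1 / Gamma (\<alpha> - 1) * J (\<lambda>y. LINT s|M. (if s < y then (y - s) powr ?b * g s else 0)) x"
    unfolding fracI_def[of \<alpha> "J g"] J_def[of "\<lambda>y. LINT s|M. (if s < y then (y - s) powr ?b * g s else 0)"] * ..
  also have "\<dots> = J (fracI \<alpha> g) x"
    unfolding fracI_def J_cmult ..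
  finally show ?thesis .
qed

text \<open>By reflection, the kernel (x - t)^(alpha - 2) may be replaced by t^(alpha - 2). A
  nonzero value of u at 0 thus contributes a derivative singular at 0.\<close>

lemma fracI_const:
  assumes x: "x \<in> {0..1}"
  shows "fracI \<alpha> (\<lambda>t. c) x = J (\<lambda>y. c * (y powr (\<alpha> - 2) / Gamma (\<alpha> - 1))) x"
proof -
  let ?b = "\<alpha> - 2"
  have b: "-1 < ?b" using \<alpha> by simp
  have "(LINT t|M. (if t < x then (x - t) powr ?b * c else 0)) = c * (LINT t|M. (if 0 < t \<and> t < x then (x - t) powr ?b else 0))"
    unfolding integral_mult_right_zero[symmetric] by (intro Bochner_Integration.integral_cong) (auto simp: D_def)
  also have "\<dots> = c * (LINT t|M. (if 0 < t \<and> t < x then (t - 0) powr ?b else 0))"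
    using powr_kernel_left(2)[of 0 x ?b] powr_kernel_right(2)[of 0 x ?b] b x by simp
  also have "\<dots> = c * J (\<lambda>y. y powr ?b) x"
    unfolding J_def by (intro arg_cong2[where f = "(*)"] Bochner_Integration.integral_cong) (auto simp: D_def)
  finally show ?thesis by (simp add: fracI_def J_cmult divide_inverse J_cmult[of "inverse _", simplified mult.commute[of _ "inverse _"]] mult.commute)
qed

lemma L2_powr: "L2 (\<lambda>y. y powr (\<alpha> - 2) / Gamma (\<alpha> - 1))"
proof -
  have "integrable M (\<lambda>t. if 0 < t \<and> t < 1 then (t - 0) powr (2 * \<alpha> - 4) else 0)"
    using powr_kernel_right(1)[of 0 1 "2 * \<alpha> - 4"] \<alpha> by simp
  also have "?this \<longleftrightarrow> integrable M (\<lambda>t. (t powr (\<alpha> - 2))\<^sup>2)"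
    by (intro Bochner_Integration.integrable_cong) (auto simp: D_def power2_eq_square powr_add[symmetric])
  finally have "L2 (\<lambda>y. y powr (\<alpha> - 2))" by (simp add: L2_iff)
  then show ?thesis using L2_cmult[of "\<lambda>y. y powr (\<alpha> - 2)" "1 / Gamma (\<alpha> - 1)"] by simp
qed

end

section \<open>The weak problem\<close>

lemma l2_norm_AE_mult:
  assumes u: "L2 u" and q: "q \<in> borel_measurable M" "AE x in M. \<bar>q x\<bar> \<le> C" and C: "0 \<le> C"
  shows "l2_norm (\<lambda>x. q x * u x) \<le> C * l2_norm u"
proof -
  have "l2_norm (\<lambda>x. q x * u x) \<le> l2_norm (\<lambda>x. C * u x)"
  proof (rule l2_norm_mono[OF L2_cmult[OF u] L2_measurable[OF L2_AE_mult[OF u q]]])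
    show "AE x in M. \<bar>q x * u x\<bar> \<le> \<bar>C * u x\<bar>"
      using q(2) by eventually_elim (use C in \<open>auto simp: abs_mult intro: mult_right_mono\<close>)
  qed
  then show ?thesis using C by (simp add: l2_norm_cmult)
qed

text \<open>Multiply out (c + J u') (d + J v') and use \<open>J_mult\<close> for the last product.
  The derivative is in L2 because primitives of L2 functions are bounded.\<close>

lemma H1_mult:
  assumes u: "H1 u" and v: "H1 v"
  shows "H1 (\<lambda>x. u x * v x)" "AE x in M. wd (\<lambda>x. u x * v x) x = wd u x * v x + u x * wd v x"
proof -
  obtain c where c: "AE x in M. u x = c + J (wd u) x" using H1E[OF u] .
  obtain d where d: "AE x in M. v x = d + J (wd v) x" using H1E[OF v] .
  let ?a = "wd u" and ?b = "wd v"
  note ab = wd_spec(1)[OF u] wd_spec(1)[OF v]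
  note [measurable] = L2_measurable[OF ab(1)] L2_measurable[OF ab(2)]
    L2_measurable[OF H1_L2[OF u]] L2_measurable[OF H1_L2[OF v]]
  let ?h = "\<lambda>x. J ?a x * ?b x + ?a x * J ?b x"
  let ?g = "\<lambda>x. (c * ?b x + d * ?a x) + ?h x"
  have "AE x in M. \<bar>J ?a x\<bar> \<le> l2_norm ?a" "AE x in M. \<bar>J ?b x\<bar> \<le> l2_norm ?b"
    using J_bound[OF ab(1) D_imp_Icc] J_bound[OF ab(2) D_imp_Icc] by (auto intro!: AE_DI)
  from L2_AE_mult[OF ab(2) _ this(1)] L2_AE_mult[OF ab(1) _ this(2)]
  have h: "L2 ?h" by (subst (2) mult.commute) (auto intro!: L2_add)
  have g: "L2 ?g" by (rule L2_add[OF L2_add[OF L2_cmult[OF ab(2)] L2_cmult[OF ab(1)]] h])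
  have J: "J ?g x = c * J ?b x + d * J ?a x + J ?a x * J ?b x" for x
  proof -
    have "J ?g x = J (\<lambda>x. c * ?b x + d * ?a x) x + J ?h x"
      by (rule J_add[OF L2_integrable[OF L2_add[OF L2_cmult[OF ab(2)] L2_cmult[OF ab(1)]]] L2_integrable[OF h]])
    also have "J (\<lambda>x. c * ?b x + d * ?a x) x = c * J ?b x + d * J ?a x"
      using ab by (simp add: J_add J_cmult L2_integrable)
    also have "J ?h x = J ?a x * J ?b x"
      using ab by (intro J_mult[symmetric] L2_integrable)
    finally show ?thesis .
  qed
  have "AE x in M. u x * v x = c * d + J ?g x"
    using c d
  proof eventually_elim
    case (elim x)
    show ?case unfolding J by (simp only: elim) (simp add: algebra_simps)
  qed
  from H1I[OF _ g this] have "H1 (\<lambda>x. u x * v x)" "AE x in M. wd (\<lambda>x. u x * v x) x = ?g x"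
    by simp_all
  then show "H1 (\<lambda>x. u x * v x)" by simp
  show "AE x in M. wd (\<lambda>x. u x * v x) x = wd u x * v x + u x * wd v x"
    using c d \<open>AE x in M. wd (\<lambda>x. u x * v x) x = ?g x\<close>
    by eventually_elim (simp add: algebra_simps)
qed

section \<open>The form as a function of the derivative, and solutions\<close>

text \<open>\<open>A_form\<close> sees its first argument only through the weak derivative; as a
  form in u = \<psi>' it is defined on L2 and can be estimated there.\<close>

definition B_form :: "real \<Rightarrow> (real \<Rightarrow> real) \<Rightarrow> (real \<Rightarrow> real) \<Rightarrow> (real \<Rightarrow> real) \<Rightarrow> (real \<Rightarrow> real) \<Rightarrow> real" where
  "B_form \<alpha> q p u \<phi> = l2_inner u (wd \<phi>) + l2_inner (fracI \<alpha> u) (\<lambda>x. q x * \<phi> x) + fracI \<alpha> u 1 * l2_inner p \<phi>"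

lemma A_form_eq: "A_form \<alpha> q p \<psi> \<phi> = B_form \<alpha> q p (wd \<psi>) \<phi>"
proof -
  have "l2_inner (RL \<alpha> \<psi>) (\<lambda>x. q x * \<phi> x) = l2_inner (fracI \<alpha> (wd \<psi>)) (\<lambda>x. q x * \<phi> x)"
    unfolding l2_inner_eq by (intro Bochner_Integration.integral_cong) (auto simp: RL_eq_fracI D_def)
  then show ?thesis by (simp add: A_form_def B_form_def RL_eq_fracI)
qed

lemma l2_inner_cmult: "l2_inner (\<lambda>x. c * u x) v = c * l2_inner u v"
  by (simp add: l2_inner_eq mult.assoc)

lemma l2_inner_diff:
  assumes "L2 u" "L2 v" "L2 w" shows "l2_inner (\<lambda>x. u x - v x) w = l2_inner u w - l2_inner v w"
  unfolding l2_inner_eq left_diff_distrib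
  using assms by (intro Bochner_Integration.integral_diff L2_mult)

lemma l2_inner_cong: "(\<And>x. x \<in> D \<Longrightarrow> u x = u' x) \<Longrightarrow> l2_inner u v = l2_inner u' v"
  unfolding l2_inner_eq by (intro Bochner_Integration.integral_cong) auto

lemma B_form_cmult: "B_form \<alpha> q p (\<lambda>x. c * u x) \<phi> = c * B_form \<alpha> q p u \<phi>"
proof -
  have "fracI \<alpha> (\<lambda>x. c * u x) = (\<lambda>x. c * fracI \<alpha> u x)" by (simp add: fun_eq_iff fracI_cmult)
  then show ?thesis by (simp add: B_form_def l2_inner_cmult algebra_simps)
qed

definition sol :: "real \<Rightarrow> (real \<Rightarrow> real) \<Rightarrow> (real \<Rightarrow> real) \<Rightarrow> (real \<Rightarrow> real) \<Rightarrow> (real \<Rightarrow> real) \<Rightarrow> bool" where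
  "sol \<alpha> q p f w \<longleftrightarrow> L2 f \<and> H10 w \<and> (\<forall>\<phi>. H10 \<phi> \<longrightarrow> A_form \<alpha> q p w \<phi> = l2_inner f \<phi>)"

lemma Linf_bound: assumes "Linf q" obtains C where "0 \<le> C" "AE x in M. \<bar>q x\<bar> \<le> C"
proof -
  obtain C where C: "AE x in M. \<bar>q x\<bar> \<le> C" using assms by (auto simp: Linf_def AE_D)
  then have "AE x in M. \<bar>q x\<bar> \<le> \<bar>C\<bar>" by eventually_elim simp
  then show ?thesis by (rule that[rotated]) simp
qed

context
  fixes \<alpha> :: real and q p :: "real \<Rightarrow> real"
  assumes \<alpha>: "3/2 < \<alpha>" "\<alpha> < 2" and q: "Linf q" and p: "L2 p"
begin

lemma L2_q_mult: assumes "L2 u" shows "L2 (\<lambda>x. q x * u x)"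
proof -
  obtain C where "AE x in M. \<bar>q x\<bar> \<le> C" using Linf_bound[OF q] .
  then show ?thesis using L2_AE_mult[OF assms Linf_measurable[OF q]] by blast
qed

text \<open>Continuity in the first argument for fixed \<phi>. It serves twice: to pass to the limit
  along solutions, and at distance 0 to make the form independent of the choice behind
  \<open>wd\<close>.\<close>

lemma B_form_diff:
  assumes u: "L2 u" "L2 v" and \<phi>: "H1 \<phi>"
  shows "\<bar>B_form \<alpha> q p u \<phi> - B_form \<alpha> q p v \<phi>\<bar> \<le>
    (l2_norm (wd \<phi>) + fracI_bound \<alpha> * l2_norm (\<lambda>x. q x * \<phi> x) + fracI_bound \<alpha> * l2_norm p * l2_norm \<phi>) * l2_norm (\<lambda>x. u x - v x)"
proof -
  let ?d = "\<lambda>x. u x - v x"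
  have d: "L2 ?d" using u by blast
  note Td = fracI_add_diff(2)[OF \<alpha> u]
  have a: "l2_inner u (wd \<phi>) - l2_inner v (wd \<phi>) = l2_inner ?d (wd \<phi>)"
    using l2_inner_diff[OF u wd_spec(1)[OF \<phi>]] by simp
  have b: "l2_inner (fracI \<alpha> u) (\<lambda>x. q x * \<phi> x) - l2_inner (fracI \<alpha> v) (\<lambda>x. q x * \<phi> x) = l2_inner (fracI \<alpha> ?d) (\<lambda>x. q x * \<phi> x)"
    using l2_inner_diff[OF fracI_L2(1)[OF \<alpha> u(1)] fracI_L2(1)[OF \<alpha> u(2)] L2_q_mult[OF H1_L2[OF \<phi>]]]
      l2_inner_cong[OF Td[OF D_imp_Icc], of "\<lambda>x. x"] by simp
  have c: "fracI \<alpha> u 1 - fracI \<alpha> v 1 = fracI \<alpha> ?d 1" using Td[of 1] by simp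
  have "B_form \<alpha> q p u \<phi> - B_form \<alpha> q p v \<phi> = l2_inner ?d (wd \<phi>) + l2_inner (fracI \<alpha> ?d) (\<lambda>x. q x * \<phi> x) + fracI \<alpha> ?d 1 * l2_inner p \<phi>"
    unfolding B_form_def a[symmetric] b[symmetric] c[symmetric] by (simp add: algebra_simps)
  moreover have "\<bar>l2_inner ?d (wd \<phi>)\<bar> \<le> l2_norm ?d * l2_norm (wd \<phi>)"
    by (rule l2_Cauchy_Schwarz[OF d wd_spec(1)[OF \<phi>]])
  moreover have "\<bar>l2_inner (fracI \<alpha> ?d) (\<lambda>x. q x * \<phi> x)\<bar> \<le> (fracI_bound \<alpha> * l2_norm ?d) * l2_norm (\<lambda>x. q x * \<phi> x)"
    by (rule order_trans[OF l2_Cauchy_Schwarz[OF fracI_L2(1)[OF \<alpha> d] L2_q_mult[OF H1_L2[OF \<phi>]]]])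
      (intro mult_right_mono fracI_L2(2)[OF \<alpha> d] l2_norm_nonneg)
  moreover have "\<bar>fracI \<alpha> ?d 1 * l2_inner p \<phi>\<bar> \<le> (fracI_bound \<alpha> * l2_norm ?d) * (l2_norm p * l2_norm \<phi>)"
    unfolding abs_mult using fracI_bound_nonneg[OF \<alpha>]
    by (intro mult_mono fracI_le[OF \<alpha> d] l2_Cauchy_Schwarz[OF p H1_L2[OF \<phi>]]) auto
  ultimately have "\<bar>B_form \<alpha> q p u \<phi> - B_form \<alpha> q p v \<phi>\<bar> \<le> l2_norm ?d * l2_norm (wd \<phi>) +
    (fracI_bound \<alpha> * l2_norm ?d) * l2_norm (\<lambda>x. q x * \<phi> x) + (fracI_bound \<alpha> * l2_norm ?d) * (l2_norm p * l2_norm \<phi>)"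
    by linarith
  then show ?thesis by (simp add: algebra_simps)
qed

lemma B_form_cong_AE:
  assumes u: "L2 u" "L2 v" "AE x in M. u x = v x" and \<phi>: "H1 \<phi>"
  shows "B_form \<alpha> q p u \<phi> = B_form \<alpha> q p v \<phi>"
proof -
  have "AE x in M. u x - v x = 0" using u(3) by eventually_elim simp
  then have "l2_norm (\<lambda>x. u x - v x) = 0" by (subst l2_norm_eq_0_iff[OF L2_diff[OF u(1,2)]])
  then show ?thesis using B_form_diff[OF u(1,2) \<phi>] by simp
qed

lemma sol_cmult:
  assumes "sol \<alpha> q p f w" shows "sol \<alpha> q p (\<lambda>x. c * f x) (\<lambda>x. c * w x)"
proof -
  have w: "H10 w" "L2 f" using assms by (auto simp: sol_def)
  note h = H10_H1[OF w(1)]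
  have "A_form \<alpha> q p (\<lambda>x. c * w x) \<phi> = l2_inner (\<lambda>x. c * f x) \<phi>" if \<phi>: "H10 \<phi>" for \<phi>
  proof -
    have "B_form \<alpha> q p (wd (\<lambda>x. c * w x)) \<phi> = B_form \<alpha> q p (\<lambda>x. c * wd w x) \<phi>"
      using wd_spec(1)[OF H1_cmult(1)[OF h]] L2_cmult[OF wd_spec(1)[OF h]] H1_cmult(2)[OF h] H10_H1[OF \<phi>]
      by (rule B_form_cong_AE)
    then show ?thesis using assms \<phi> by (simp add: sol_def A_form_eq B_form_cmult l2_inner_cmult)
  qed
  then show ?thesis using w by (auto simp: sol_def intro: H10_cmult)
qed

text \<open>On test functions the weak form is the defining identity for a weak derivative of w'.
  The explicit formula is kept because the H3 part differentiates it.\<close>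

lemma sol_second_deriv:
  assumes "sol \<alpha> q p f w"
  defines "G \<equiv> \<lambda>x. q x * fracI \<alpha> (wd w) x + fracI \<alpha> (wd w) 1 * p x - f x"
  shows "L2 G" "H1 (wd w)" "AE x in M. wd (wd w) x = G x"
proof -
  have w: "H10 w" and f: "L2 f" using assms by (auto simp: sol_def)
  note u = wd_spec(1)[OF H10_H1[OF w]]
  note Tq = L2_q_mult[OF fracI_L2(1)[OF \<alpha> u]]
  show G: "L2 G" unfolding G_def by (rule L2_diff[OF L2_add[OF Tq L2_cmult[OF p]] f])
  have "weak_deriv (wd w) G"
    unfolding weak_deriv_iff
  proof (intro allI impI)
    fix \<phi> assume \<phi>: "test_fun \<phi>"
    note t = test_fun_deriv[OF \<phi>]
    have *: "A_form \<alpha> q p w \<phi> = l2_inner f \<phi>" using assms test_fun_H10[OF \<phi>] by (auto simp: sol_def)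
    have "l2_inner (wd w) (wd \<phi>) = (LINT x|M. wd w x * deriv \<phi> x)"
      unfolding l2_inner_eq
    proof (rule integral_cong_AE)
      note [measurable] = L2_measurable[OF u] L2_measurable[OF wd_spec(1)[OF test_fun_H1(1)[OF \<phi>]]] L2_measurable[OF t(3)]
      show "(\<lambda>x. wd w x * wd \<phi> x) \<in> borel_measurable M" by measurable
      show "(\<lambda>x. wd w x * deriv \<phi> x) \<in> borel_measurable M" by measurable
      show "AE x in M. wd w x * wd \<phi> x = wd w x * deriv \<phi> x" using test_fun_H1(2)[OF \<phi>] by eventually_elim simp
    qed
    moreover have "(LINT x|M. G x * \<phi> x) = l2_inner (fracI \<alpha> (wd w)) (\<lambda>x. q x * \<phi> x) + fracI \<alpha> (wd w) 1 * l2_inner p \<phi> - l2_inner f \<phi>"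
    proof -
      have "(LINT x|M. G x * \<phi> x) = (LINT x|M. ((q x * fracI \<alpha> (wd w) x) * \<phi> x + fracI \<alpha> (wd w) 1 * (p x * \<phi> x)) - f x * \<phi> x)"
        unfolding G_def by (simp add: algebra_simps)
      also have "\<dots> = (LINT x|M. (q x * fracI \<alpha> (wd w) x) * \<phi> x) + fracI \<alpha> (wd w) 1 * (LINT x|M. p x * \<phi> x) - (LINT x|M. f x * \<phi> x)"
        using L2_mult[OF Tq t(2)] L2_mult[OF p t(2)] L2_mult[OF f t(2)] by simp
      also have "(LINT x|M. (q x * fracI \<alpha> (wd w) x) * \<phi> x) = l2_inner (fracI \<alpha> (wd w)) (\<lambda>x. q x * \<phi> x)"
        by (simp add: l2_inner_eq ac_simps)
      finally show ?thesis by (simp add: l2_inner_eq)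
    qed
    ultimately show "(LINT x|M. wd w x * deriv \<phi> x) = - (LINT x|M. G x * \<phi> x)"
      using * by (simp add: A_form_eq B_form_def)
  qed
  then show "H1 (wd w)" "AE x in M. wd (wd w) x = G x" using wd_AE[OF u G] by blast+
qed

lemma sol_second_deriv_bound:
  obtains K where "0 \<le> K"
    "\<And>f w. sol \<alpha> q p f w \<Longrightarrow> l2_norm (wd (wd w)) \<le> K * l2_norm (wd w) + l2_norm f"
proof -
  obtain C where C: "0 \<le> C" "AE x in M. \<bar>q x\<bar> \<le> C" using Linf_bound[OF q] .
  show ?thesis
  proof
    \<comment> \<open>C pays for the multiplication by q, \<open>l2_norm p\<close> for the nonlocal
      term; both contain one fractional integral of w'.\<close>
    show "0 \<le> (C + l2_norm p) * fracI_bound \<alpha>" using C fracI_bound_nonneg[OF \<alpha>] by simp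
    fix f w assume s: "sol \<alpha> q p f w"
    then have w: "H10 w" and f: "L2 f" by (auto simp: sol_def)
    note u = wd_spec(1)[OF H10_H1[OF w]]
    note Tu = fracI_L2[OF \<alpha> u]
    note Tq = L2_q_mult[OF Tu(1)]
    have "l2_norm (wd (wd w)) = l2_norm (\<lambda>x. q x * fracI \<alpha> (wd w) x + fracI \<alpha> (wd w) 1 * p x - f x)"
      using sol_second_deriv[OF s] by (intro l2_norm_cong_AE wd_spec(1))
    also have "\<dots> \<le> l2_norm (\<lambda>x. q x * fracI \<alpha> (wd w) x + fracI \<alpha> (wd w) 1 * p x) + l2_norm f"
      by (rule l2_norm_triangle_diff[OF L2_add[OF Tq L2_cmult[OF p]] f])
    also have "l2_norm (\<lambda>x. q x * fracI \<alpha> (wd w) x + fracI \<alpha> (wd w) 1 * p x) \<le>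
        l2_norm (\<lambda>x. q x * fracI \<alpha> (wd w) x) + \<bar>fracI \<alpha> (wd w) 1\<bar> * l2_norm p"
      unfolding l2_norm_cmult[symmetric] by (rule l2_norm_triangle[OF Tq L2_cmult[OF p]])
    also have "l2_norm (\<lambda>x. q x * fracI \<alpha> (wd w) x) \<le> C * l2_norm (fracI \<alpha> (wd w))"
      by (rule l2_norm_AE_mult[OF Tu(1) Linf_measurable[OF q] C(2,1)])
    also have "\<dots> \<le> C * (fracI_bound \<alpha> * l2_norm (wd w))" by (rule mult_left_mono[OF Tu(2) C(1)])
    also have "\<bar>fracI \<alpha> (wd w) 1\<bar> * l2_norm p \<le> (fracI_bound \<alpha> * l2_norm (wd w)) * l2_norm p"
      by (intro mult_right_mono fracI_le[OF \<alpha> u]) auto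
    finally show "l2_norm (wd (wd w)) \<le> (C + l2_norm p) * fracI_bound \<alpha> * l2_norm (wd w) + l2_norm f"
      by (simp add: algebra_simps)
  qed
qed

end

section \<open>Compactness and the a priori estimate\<close>

context
  fixes \<alpha> :: real and q p :: "real \<Rightarrow> real"
  assumes \<alpha>: "3/2 < \<alpha>" "\<alpha> < 2" and q: "Linf q" and p: "L2 p"
begin

text \<open>The equation itself bounds w'' by K + 1, so the representatives c + J w'' of w' satisfy
  the assumptions of Arzela-Ascoli on the closed interval; uniform convergence there implies L2
  convergence.\<close>

lemma sol_compactness:
  fixes F W :: "nat \<Rightarrow> real \<Rightarrow> real"
  assumes s: "\<And>n. sol \<alpha> q p (F n) (W n)" and norm_W: "\<And>n. l2_norm (wd (W n)) = 1"
    and norm_F: "\<And>n. l2_norm (F n) \<le> 1"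
  obtains g k where "L2 g" "strict_mono (k :: nat \<Rightarrow> nat)"
    "(\<lambda>n. l2_norm (\<lambda>x. wd (W (k n)) x - g x)) \<longlonglongrightarrow> 0"
proof -
  obtain K where K: "0 \<le> K" and
    bound: "\<And>f w. sol \<alpha> q p f w \<Longrightarrow> l2_norm (wd (wd w)) \<le> K * l2_norm (wd w) + l2_norm f"
    using sol_second_deriv_bound[OF \<alpha> q p] by blast
  define G where "G n = wd (wd (W n))" for n
  note H = sol_second_deriv(2)[OF \<alpha> q p s]
  note L2_G = wd_spec(1)[OF H, folded G_def] and L2_u = H1_L2[OF H]
  have norm_G: "l2_norm (G n) \<le> K + 1" for n
    using bound[OF s[of n]] norm_W[of n] norm_F[of n] by (simp add: G_def)
  have "\<exists>c. AE x in M. wd (W n) x = c + J (G n) x" for n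
    using H1E[OF H[of n]] unfolding G_def by blast
  then obtain c where c: "\<And>n. AE x in M. wd (W n) x = c n + J (G n) x" by metis
  \<comment> \<open>The constant is w' - J w'', of norm at most 1 + (K + 1). Adding the bound K + 1
    of the primitive gives 2 K + 3 below.\<close>
  have c_bound: "\<bar>c n\<bar> \<le> K + 2" for n
  proof -
    have "AE x in M. wd (W n) x - J (G n) x = c n" using c[of n] by eventually_elim simp
    then have "l2_norm (\<lambda>x. wd (W n) x - J (G n) x) = l2_norm (\<lambda>x. c n)"
      by (intro l2_norm_cong_AE L2_diff L2_u J_L2 L2_G L2_const)
    then have "\<bar>c n\<bar> = l2_norm (\<lambda>x. wd (W n) x - J (G n) x)" by simp
    also have "\<dots> \<le> l2_norm (wd (W n)) + l2_norm (J (G n))"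
      by (rule l2_norm_triangle_diff[OF L2_u J_L2[OF L2_G]])
    finally show ?thesis using J_norm[OF L2_G, of n] norm_G[of n] norm_W[of n] by linarith
  qed
  let ?v = "\<lambda>n x. c n + J (G n) x"
  have v_bound: "norm (?v n x) \<le> 2 * K + 3" if "x \<in> {0..1}" for n x
    using c_bound[of n] J_bound[OF L2_G that, of n] norm_G[of n] unfolding real_norm_def by linarith
  have v_equi: "norm (?v n x - ?v n y) \<le> sqrt \<bar>x - y\<bar> * (K + 1)" if "x \<in> {0..1}" "y \<in> {0..1}" for n x y
  proof -
    have "norm (?v n x - ?v n y) \<le> sqrt \<bar>x - y\<bar> * l2_norm (G n)"
      using J_Hoelder[OF L2_G that, of n] by simp
    also have "\<dots> \<le> sqrt \<bar>x - y\<bar> * (K + 1)" by (intro mult_left_mono norm_G) simp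
    finally show ?thesis .
  qed
  have "\<exists>d. 0 < d \<and> (\<forall>n y. y \<in> {0..1} \<and> norm (x - y) < d \<longrightarrow> norm (?v n x - ?v n y) < e)"
    if x: "x \<in> {0..1}" and e: "0 < e" for x e
  \<comment> \<open>Inverts the common modulus of continuity sqrt d * (K + 1).\<close>
  proof (intro exI[of _ "(e / (K + 1))\<^sup>2"] conjI allI impI)
    show "0 < (e / (K + 1))\<^sup>2" using e K by simp
    fix n y assume y: "y \<in> {0..1} \<and> norm (x - y) < (e / (K + 1))\<^sup>2"
    have "sqrt \<bar>x - y\<bar> < sqrt ((e / (K + 1))\<^sup>2)" using y by (simp only: real_sqrt_less_iff real_norm_def)
    also have "\<dots> = e / (K + 1)" using e K by simp
    finally have "sqrt \<bar>x - y\<bar> * (K + 1) < e" using K by (simp add: pos_less_divide_eq)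
    then show "norm (?v n x - ?v n y) < e" using v_equi[OF x, of y n] y by linarith
  qed
  then obtain g k where g: "continuous_on {0..1} g" and k: "strict_mono (k :: nat \<Rightarrow> nat)"
    and lim: "\<And>e. 0 < e \<Longrightarrow> \<exists>N. \<forall>n x. n \<ge> N \<and> x \<in> {0..1} \<longrightarrow> norm (?v (k n) x - g x) < e"
    using Arzela_Ascoli[of "{0..1}" ?v "2 * K + 3"] v_bound compact_Icc by blast
  have g_meas: "g \<in> borel_measurable M"
    by (rule continuous_imp_measurable_on_sets_lebesgue[OF continuous_on_subset[OF g] D_sets]) (use D_imp_Icc in blast)
  have sup: "\<exists>N. \<forall>n\<ge>N. l2_norm (\<lambda>x. wd (W (k n)) x - g x) < e" if e: "0 < e" for e
  proof -
    \<comment> \<open>Half of e, because the sup bound yields only a non-strict bound on the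
      norm.\<close>
    obtain N where N: "\<And>n x. n \<ge> N \<Longrightarrow> x \<in> {0..1} \<Longrightarrow> norm (?v (k n) x - g x) < e / 2"
      using lim[of "e / 2"] e by auto
    have D: "AE x in M. x \<in> {0..1}" by (rule AE_DI[OF D_imp_Icc])
    have "l2_norm (\<lambda>x. wd (W (k n)) x - g x) \<le> e / 2" if n: "n \<ge> N" for n
    proof (rule l2_norm_bounded)
      show "(\<lambda>x. wd (W (k n)) x - g x) \<in> borel_measurable M"
        using L2_measurable[OF L2_u[of "k n"]] g_meas by simp
      show "AE x in M. \<bar>wd (W (k n)) x - g x\<bar> \<le> e / 2"
        using c[of "k n"] D
      proof eventually_elim
        case (elim x)
        then show ?case using N[OF n, of x] by simp
      qed
    qed (use e in simp)
    then show ?thesis using e by (intro exI[of _ N]) force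
  qed
  have "L2 g"
  proof -
    have "bounded (g ` {0..1})" using compact_imp_bounded[OF compact_continuous_image[OF g compact_Icc]] .
    then obtain C where C: "\<forall>y\<in>g ` {0..1}. norm y \<le> C" unfolding bounded_iff by blast
    have "AE x in M. \<bar>g x\<bar> \<le> C"
      using bspec[OF C imageI[OF D_imp_Icc]] by (intro AE_DI) (simp only: real_norm_def)
    then show ?thesis by (rule L2_bounded[OF g_meas])
  qed
  moreover have "(\<lambda>n. l2_norm (\<lambda>x. wd (W (k n)) x - g x)) \<longlonglongrightarrow> 0"
    using sup by (intro LIMSEQ_I) simp
  ultimately show ?thesis using k that by blast
qed

lemma sol_a_priori:
  assumes inj: "\<And>w. H10 w \<Longrightarrow> (\<forall>v. H10 v \<longrightarrow> A_form \<alpha> q p w v = 0) \<Longrightarrow> ae_zero w"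
  shows "\<exists>c\<ge>0. \<forall>f w. sol \<alpha> q p f w \<longrightarrow> l2_norm (wd w) \<le> c * l2_norm f"
proof (rule ccontr)
  assume "\<not> ?thesis"
  \<comment> \<open>The candidate constants are n + 1, so after normalisation the right-hand sides
    are at most 1 / (n + 1).\<close>
  then have "\<exists>f w. sol \<alpha> q p f w \<and> \<not> l2_norm (wd w) \<le> real (Suc n) * l2_norm f" for n
    by (metis of_nat_0_le_iff)
  then obtain f w where s: "\<And>n. sol \<alpha> q p (f n) (w n)"
    and big: "\<And>n. real (Suc n) * l2_norm (f n) < l2_norm (wd (w n))" by (metis not_le)
  define N where "N n = l2_norm (wd (w n))" for n
  have N: "0 < N n" for n
    using big[of n] mult_nonneg_nonneg[OF of_nat_0_le_iff[of "Suc n"] l2_norm_nonneg[of "f n"]] unfolding N_def by linarith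
  define F where "F n = (\<lambda>x. inverse (N n) * f n x)" for n
  define W where "W n = (\<lambda>x. inverse (N n) * w n x)" for n
  have sW: "sol \<alpha> q p (F n) (W n)" for n
    unfolding F_def W_def by (rule sol_cmult[OF \<alpha> q p s])
  have h10: "H10 (W n)" and F_L2: "L2 (F n)" for n using sW[of n] by (auto simp: sol_def)
  note h1 = H10_H1[OF h10]
  have W1: "l2_norm (wd (W n)) = 1" for n
  proof -
    have w: "H1 (w n)" using s[of n] by (auto simp: sol_def H10_H1)
    have "l2_norm (wd (W n)) = l2_norm (\<lambda>x. inverse (N n) * wd (w n) x)"
      using H1_cmult(2)[OF w, of "inverse (N n)"]
      by (intro l2_norm_cong_AE[OF wd_spec(1)[OF h1] L2_cmult[OF wd_spec(1)[OF w]]]) (simp add: W_def)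
    then show ?thesis using N[of n] by (simp add: l2_norm_cmult N_def[symmetric])
  qed
  have F_small: "l2_norm (F n) \<le> 1 / real (Suc n)" for n
  proof -
    have "real (Suc n) * l2_norm (f n) \<le> N n" using big[of n] by (simp add: N_def)
    then show ?thesis using N[of n] unfolding F_def l2_norm_cmult by (simp add: field_simps)
  qed
  have F1: "l2_norm (F n) \<le> 1" for n
  proof -
    have "1 / real (Suc n) \<le> 1" by simp
    with F_small[of n] show ?thesis by (rule order_trans)
  qed
  obtain g k where g: "L2 g" and k: "strict_mono (k :: nat \<Rightarrow> nat)"
    and lim: "(\<lambda>n. l2_norm (\<lambda>x. wd (W (k n)) x - g x)) \<longlonglongrightarrow> 0"
    by (rule sol_compactness[OF sW W1 F1])
  \<comment> \<open>The candidate for a nontrivial solution of the homogeneous problem. It belongs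
    to \<open>H10\<close> only once the convergence of both functions and derivatives is
    known.\<close>
  let ?w = "J g"
  have "AE x in M. ?w x = 0 + J g x" by simp
  note Hw = H1I[OF L2_measurable[OF J_L2[OF g]] g this]
  note L2_u = wd_spec(1)[OF h1] and L2_w = wd_spec(1)[OF Hw(1)]
  have lim2: "(\<lambda>n. l2_norm (\<lambda>x. wd (W (k n)) x - wd ?w x)) \<longlonglongrightarrow> 0"
  proof -
    have "l2_norm (\<lambda>x. wd (W (k n)) x - wd ?w x) = l2_norm (\<lambda>x. wd (W (k n)) x - g x)" for n
    proof (rule l2_norm_cong_AE[OF L2_diff[OF L2_u L2_w] L2_diff[OF L2_u g]])
      show "AE x in M. wd (W (k n)) x - wd ?w x = wd (W (k n)) x - g x"
        using Hw(2) by eventually_elim simp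
    qed
    with lim show ?thesis by simp
  qed
  have lim1: "(\<lambda>n. l2_norm (\<lambda>x. W (k n) x - ?w x)) \<longlonglongrightarrow> 0"
  proof -
    have "l2_norm (\<lambda>x. W (k n) x - ?w x) \<le> l2_norm (\<lambda>x. wd (W (k n)) x - g x)" for n
    proof -
      \<comment> \<open>Both functions are primitives with constant 0, and \<open>J\<close> does not
        increase the norm, so convergence of the derivatives suffices.\<close>
      have "l2_norm (\<lambda>x. W (k n) x - ?w x) = l2_norm (J (\<lambda>x. wd (W (k n)) x - g x))"
      proof (rule l2_norm_cong_AE[OF L2_diff[OF H1_L2[OF h1] J_L2[OF g]] J_L2[OF L2_diff[OF L2_u g]]])
        show "AE x in M. W (k n) x - J g x = J (\<lambda>x. wd (W (k n)) x - g x) x"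
          using H10_eq_J[OF h10[of "k n"]]
          by eventually_elim (simp add: J_diff[OF L2_integrable[OF L2_u] L2_integrable[OF g]])
      qed
      then show ?thesis using J_norm[OF L2_diff[OF L2_u g]] by simp
    qed
    then show ?thesis
      by (intro tendsto_sandwich[OF always_eventually always_eventually tendsto_const lim]) auto
  qed
  have w10: "H10 ?w" by (rule H10_closed[OF Hw(1) h10 lim1 lim2])
  have "A_form \<alpha> q p ?w \<phi> = 0" if \<phi>: "H10 \<phi>" for \<phi>
  proof -
    note \<phi>1 = H10_H1[OF \<phi>]
    let ?C = "l2_norm (wd \<phi>) + fracI_bound \<alpha> * l2_norm (\<lambda>x. q x * \<phi> x) + fracI_bound \<alpha> * l2_norm p * l2_norm \<phi>"
    have le: "\<bar>A_form \<alpha> q p ?w \<phi>\<bar> \<le> 1 / real (Suc n) * l2_norm \<phi> + ?C * l2_norm (\<lambda>x. wd (W (k n)) x - wd ?w x)" for n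
    proof -
      have "\<bar>A_form \<alpha> q p (W (k n)) \<phi> - A_form \<alpha> q p ?w \<phi>\<bar> \<le> ?C * l2_norm (\<lambda>x. wd (W (k n)) x - wd ?w x)"
        unfolding A_form_eq by (rule B_form_diff[OF \<alpha> q p L2_u L2_w \<phi>1])
      moreover have "A_form \<alpha> q p (W (k n)) \<phi> = l2_inner (F (k n)) \<phi>"
        using sW[of "k n"] \<phi> by (auto simp: sol_def)
      moreover have "\<bar>l2_inner (F (k n)) \<phi>\<bar> \<le> l2_norm (F (k n)) * l2_norm \<phi>"
        by (rule l2_Cauchy_Schwarz[OF F_L2 H1_L2[OF \<phi>1]])
      moreover have "l2_norm (F (k n)) * l2_norm \<phi> \<le> 1 / real (Suc n) * l2_norm \<phi>"
      proof (intro mult_right_mono)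
        have "1 / real (Suc (k n)) \<le> 1 / real (Suc n)"
          using seq_suble[OF k, of n] by (intro divide_left_mono) auto
        then show "l2_norm (F (k n)) \<le> 1 / real (Suc n)" using F_small[of "k n"] by linarith
      qed simp
      ultimately show ?thesis by linarith
    qed
    have "(\<lambda>n. 1 / real (Suc n) * l2_norm \<phi> + ?C * l2_norm (\<lambda>x. wd (W (k n)) x - wd ?w x)) \<longlonglongrightarrow> 0 * l2_norm \<phi> + ?C * 0"
      using LIMSEQ_Suc[OF lim_1_over_n] by (intro tendsto_intros lim2)
    then have "\<bar>A_form \<alpha> q p ?w \<phi>\<bar> \<le> 0"
      using tendsto_lowerbound[of _ 0 sequentially "\<bar>A_form \<alpha> q p ?w \<phi>\<bar>"] le by simp
    then show ?thesis by simp
  qed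
  then have "ae_zero ?w" using inj w10 by blast
  \<comment> \<open>Written as a primitive of 0, the limit has derivative 0, while derivatives of
    norm 1 converge to it.\<close>
  then have "AE x in M. ?w x = 0 + J (\<lambda>x. 0) x"
    unfolding ae_zero_def AE_D by eventually_elim (simp add: J_def)
  from H1I(2)[OF L2_measurable[OF J_L2[OF g]] L2_const this]
  have w0: "l2_norm (wd ?w) = 0" using l2_norm_eq_0_iff[OF L2_w] by simp
  have "1 \<le> l2_norm (\<lambda>x. wd (W (k n)) x - wd ?w x)" for n
    using l2_norm_triangle[OF L2_diff[OF L2_u[of "k n"] L2_w] L2_w] W1[of "k n"] w0 by simp
  then have "1 \<le> (0::real)"
    using tendsto_lowerbound[OF lim2, of 1] by simp
  then show False by simp
qed

lemma sol_H2:
  assumes inj: "\<And>w. H10 w \<Longrightarrow> (\<forall>v. H10 v \<longrightarrow> A_form \<alpha> q p w v = 0) \<Longrightarrow> ae_zero w"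
  obtains c where "0 \<le> c" "\<And>f w. sol \<alpha> q p f w \<Longrightarrow> H2 w"
    "\<And>f w. sol \<alpha> q p f w \<Longrightarrow> l2_norm w + l2_norm (wd w) + l2_norm (wd (wd w)) \<le> c * l2_norm f"
proof -
  obtain c where c: "0 \<le> c" "\<And>f w. sol \<alpha> q p f w \<Longrightarrow> l2_norm (wd w) \<le> c * l2_norm f"
    using sol_a_priori[OF inj] by blast
  obtain K where K: "0 \<le> K"
    "\<And>f w. sol \<alpha> q p f w \<Longrightarrow> l2_norm (wd (wd w)) \<le> K * l2_norm (wd w) + l2_norm f"
    using sol_second_deriv_bound[OF \<alpha> q p] by blast
  show ?thesis
  proof
    \<comment> \<open>One c for w', one for w since ||w|| <= ||w'||, and K c + 1 for w''.\<close>
    show "0 \<le> 2 * c + K * c + 1" using c(1) K(1) by simp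
    fix f w assume s: "sol \<alpha> q p f w"
    then have w: "H10 w" by (auto simp: sol_def)
    then show "H2 w" using sol_second_deriv(2)[OF \<alpha> q p s] H10_H1 by (auto simp: H2_def)
    note u = wd_spec(1)[OF H10_H1[OF w]]
    have "l2_norm w \<le> l2_norm (wd w)"
      using l2_norm_cong_AE[OF H1_L2[OF H10_H1[OF w]] J_L2[OF u] H10_eq_J[OF w]] J_norm[OF u] by simp
    moreover have "l2_norm (wd (wd w)) \<le> K * (c * l2_norm f) + l2_norm f"
      using K(2)[OF s] mult_left_mono[OF c(2)[OF s] K(1)] by linarith
    ultimately show "l2_norm w + l2_norm (wd w) + l2_norm (wd (wd w)) \<le> (2 * c + K * c + 1) * l2_norm f"
      using c(2)[OF s] by (simp add: algebra_simps)
  qed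
qed

section \<open>One more derivative\<close>

lemma fracI_H1:
  assumes u: "H1 u"
  shows "H1 (fracI \<alpha> u)"
    "l2_norm (wd (fracI \<alpha> u)) \<le> (l2_norm (\<lambda>y. y powr (\<alpha> - 2) / Gamma (\<alpha> - 1)) + fracI_bound \<alpha>) * (l2_norm u + l2_norm (wd u))"
proof -
  obtain c where c: "AE x in M. u x = c + J (wd u) x" using H1E[OF u] .
  let ?k = "\<lambda>y. y powr (\<alpha> - 2) / Gamma (\<alpha> - 1)"
  note g = wd_spec(1)[OF u] and k = L2_powr[OF \<alpha>] and uL = H1_L2[OF u]
  note Tg = fracI_L2[OF \<alpha> g]
  let ?h = "\<lambda>y. c * ?k y + fracI \<alpha> (wd u) y"
  have h: "L2 ?h" by (rule L2_add[OF L2_cmult[OF k] Tg(1)])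
  \<comment> \<open>The representation of u holds a.e. only, but the pointwise bound makes
    \<open>fracI\<close> vanish on null functions, so the identity is obtained at every x.\<close>
  have "fracI \<alpha> u x = 0 + J ?h x" if x: "x \<in> {0..1}" for x
  proof -
    have "L2 (\<lambda>t. c + J (wd u) t)" by (rule L2_add[OF L2_const J_L2[OF g]])
    then have d: "L2 (\<lambda>t. u t - (c + J (wd u) t))" by (rule L2_diff[OF uL])
    have "AE x in M. u x - (c + J (wd u) x) = 0" using c by eventually_elim simp
    then have "l2_norm (\<lambda>t. u t - (c + J (wd u) t)) = 0" by (subst l2_norm_eq_0_iff[OF d])
    then have "fracI \<alpha> (\<lambda>t. u t - (c + J (wd u) t)) x = 0" using fracI_le[OF \<alpha> d x] by simp
    then have "fracI \<alpha> u x = fracI \<alpha> (\<lambda>t. c + J (wd u) t) x"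
      using fracI_add_diff(2)[OF \<alpha> uL L2_add[OF L2_const J_L2[OF g]] x] by simp
    also have "\<dots> = J (\<lambda>y. c * ?k y) x + J (fracI \<alpha> (wd u)) x"
      using fracI_add_diff(1)[OF \<alpha> L2_const J_L2[OF g] x] fracI_const[OF \<alpha> x] fracI_J[OF \<alpha> g x] by simp
    also have "\<dots> = J ?h x"
      by (rule J_add[symmetric, OF L2_integrable[OF L2_cmult[OF k]] L2_integrable[OF Tg(1)]])
    finally show ?thesis by simp
  qed
  then have "AE x in M. fracI \<alpha> u x = 0 + J ?h x" using D_imp_Icc by (intro AE_DI) blast
  note H = H1I[OF L2_measurable[OF fracI_L2(1)[OF \<alpha> uL]] h this]
  show "H1 (fracI \<alpha> u)" by (rule H(1))
  \<comment> \<open>The constant plays the role of the value of u at 0; this is the trace estimate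
    that controls the singular term.\<close>
  have cb: "\<bar>c\<bar> \<le> l2_norm u + l2_norm (wd u)"
  proof -
    have "AE x in M. u x - J (wd u) x = c" using c by eventually_elim simp
    then have "\<bar>c\<bar> = l2_norm (\<lambda>x. u x - J (wd u) x)"
      using l2_norm_cong_AE[OF L2_diff[OF uL J_L2[OF g]] L2_const[of c]] by simp
    then show ?thesis using l2_norm_triangle_diff[OF uL J_L2[OF g]] J_norm[OF g] by linarith
  qed
  have "l2_norm (wd (fracI \<alpha> u)) = l2_norm ?h" by (rule l2_norm_cong_AE[OF wd_spec(1)[OF H(1)] h H(2)])
  also have "\<dots> \<le> \<bar>c\<bar> * l2_norm ?k + l2_norm (fracI \<alpha> (wd u))"
    unfolding l2_norm_cmult[symmetric] by (rule l2_norm_triangle[OF L2_cmult[OF k] Tg(1)])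
  also have "\<dots> \<le> (l2_norm u + l2_norm (wd u)) * l2_norm ?k + fracI_bound \<alpha> * (l2_norm u + l2_norm (wd u))"
  proof (intro add_mono mult_right_mono cb order_trans[OF Tg(2)] mult_left_mono fracI_bound_nonneg[OF \<alpha>])
  qed auto
  finally show "l2_norm (wd (fracI \<alpha> u)) \<le> (l2_norm ?k + fracI_bound \<alpha>) * (l2_norm u + l2_norm (wd u))"
    by (simp add: algebra_simps)
qed

text \<open>Differentiating q R u pairs each L2 factor with a bounded one: q' with R u, which
  \<open>fracI_le\<close> bounds, and (R u)' with q. The number (R u)(1) is a mere constant in front
  of p.\<close>

lemma sol_third_deriv:
  assumes "H1 q" "H1 p"
  obtains K where "0 \<le> K" "\<And>f w. sol \<alpha> q p f w \<Longrightarrow> H1 f \<Longrightarrow> H1 (wd (wd w))"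
    "\<And>f w. sol \<alpha> q p f w \<Longrightarrow> H1 f \<Longrightarrow>
       l2_norm (wd (wd (wd w))) \<le> K * (l2_norm (wd w) + l2_norm (wd (wd w))) + l2_norm (wd f)"
proof -
  obtain C where C: "0 \<le> C" "AE x in M. \<bar>q x\<bar> \<le> C" using Linf_bound[OF q] .
  let ?k = "l2_norm (\<lambda>y. y powr (\<alpha> - 2) / Gamma (\<alpha> - 1)) + fracI_bound \<alpha>"
  \<comment> \<open>The summands come from q' R u, from q (R u)' and from (R u)(1) p', in this
    order.\<close>
  let ?K = "fracI_bound \<alpha> * l2_norm (wd q) + C * ?k + fracI_bound \<alpha> * l2_norm (wd p)"
  note fracI_bound = fracI_bound_nonneg[OF \<alpha>] and q' = wd_spec(1)[OF assms(1)] and p' = wd_spec(1)[OF assms(2)]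
  have "H1 (wd (wd w)) \<and> l2_norm (wd (wd (wd w))) \<le> ?K * (l2_norm (wd w) + l2_norm (wd (wd w))) + l2_norm (wd f)"
    if s: "sol \<alpha> q p f w" and f: "H1 f" for f w
  proof -
    note S = sol_second_deriv[OF \<alpha> q p s]
    let ?u = "wd w" and ?t = "fracI \<alpha> (wd w) 1"
    note u = H1_L2[OF S(2)] and f' = wd_spec(1)[OF f]
    note Tu = fracI_H1[OF S(2)] and Tu' = wd_spec(1)[OF fracI_H1(1)[OF S(2)]]
    note qT = H1_mult[OF assms(1) Tu(1)]
    note a = H1_lincomb[OF qT(1) assms(2), of 1 ?t]
    note b = H1_diff[OF a(1) f]
    \<comment> \<open>The formula for w'', with a factor 1 so that it matches the linear combination
      differentiated above.\<close>
    let ?G = "\<lambda>x. 1 * (q x * fracI \<alpha> ?u x) + ?t * p x - f x"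
    have G: "AE x in M. wd ?u x = ?G x" using S(3) by simp
    note H = H1_cong_AE[OF b(1) L2_measurable[OF wd_spec(1)[OF S(2)]] G]
    let ?h = "\<lambda>x. (wd q x * fracI \<alpha> ?u x + q x * wd (fracI \<alpha> ?u) x) + ?t * wd p x - wd f x"
    have Tq: "AE x in M. \<bar>fracI \<alpha> ?u x\<bar> \<le> fracI_bound \<alpha> * l2_norm ?u"
      using fracI_le[OF \<alpha> u D_imp_Icc] by (rule AE_DI)
    have nT: "0 \<le> fracI_bound \<alpha> * l2_norm ?u" using fracI_bound by simp
    note Tm = L2_measurable[OF H1_L2[OF Tu(1)]]
    have i: "L2 (\<lambda>x. wd q x * fracI \<alpha> ?u x)" "l2_norm (\<lambda>x. wd q x * fracI \<alpha> ?u x) \<le> fracI_bound \<alpha> * l2_norm ?u * l2_norm (wd q)"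
      using L2_AE_mult[OF q' Tm Tq] l2_norm_AE_mult[OF q' Tm Tq nT] by (simp_all only: mult.commute[of "wd q _"])
    have ii: "L2 (\<lambda>x. q x * wd (fracI \<alpha> ?u) x)" "l2_norm (\<lambda>x. q x * wd (fracI \<alpha> ?u) x) \<le> C * l2_norm (wd (fracI \<alpha> ?u))"
      using L2_AE_mult[OF Tu' Linf_measurable[OF q] C(2)] l2_norm_AE_mult[OF Tu' Linf_measurable[OF q] C(2,1)] by blast+
    note iii = L2_add[OF i(1) ii(1)] and iv = L2_cmult[OF p', of ?t]
    have h: "L2 ?h" by (rule L2_diff[OF L2_add[OF iii iv] f'])
    have "AE x in M. wd (wd ?u) x = ?h x"
      using H(2) b(2) a(2) qT(2) by eventually_elim simp
    then have "l2_norm (wd (wd ?u)) = l2_norm ?h" by (rule l2_norm_cong_AE[OF wd_spec(1)[OF H(1)] h])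
    also have "\<dots> \<le> l2_norm (\<lambda>x. (wd q x * fracI \<alpha> ?u x + q x * wd (fracI \<alpha> ?u) x) + ?t * wd p x) + l2_norm (wd f)"
      by (rule l2_norm_triangle_diff[OF L2_add[OF iii iv] f'])
    also have "l2_norm (\<lambda>x. (wd q x * fracI \<alpha> ?u x + q x * wd (fracI \<alpha> ?u) x) + ?t * wd p x)
       \<le> l2_norm (\<lambda>x. wd q x * fracI \<alpha> ?u x + q x * wd (fracI \<alpha> ?u) x) + l2_norm (\<lambda>x. ?t * wd p x)"
      by (rule l2_norm_triangle[OF iii iv])
    also have "l2_norm (\<lambda>x. wd q x * fracI \<alpha> ?u x + q x * wd (fracI \<alpha> ?u) x)
       \<le> l2_norm (\<lambda>x. wd q x * fracI \<alpha> ?u x) + l2_norm (\<lambda>x. q x * wd (fracI \<alpha> ?u) x)"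
      by (rule l2_norm_triangle[OF i(1) ii(1)])
    also have "l2_norm (\<lambda>x. wd q x * fracI \<alpha> ?u x) \<le> fracI_bound \<alpha> * l2_norm (wd q) * (l2_norm ?u + l2_norm (wd ?u))"
    proof (rule order_trans[OF i(2)])
      have "(fracI_bound \<alpha> * l2_norm (wd q)) * l2_norm ?u \<le> (fracI_bound \<alpha> * l2_norm (wd q)) * (l2_norm ?u + l2_norm (wd ?u))"
        using fracI_bound by (intro mult_left_mono) auto
      then show "fracI_bound \<alpha> * l2_norm ?u * l2_norm (wd q) \<le> fracI_bound \<alpha> * l2_norm (wd q) * (l2_norm ?u + l2_norm (wd ?u))"
        by (simp only: ac_simps)
    qed
    also have "l2_norm (\<lambda>x. q x * wd (fracI \<alpha> ?u) x) \<le> C * (?k * (l2_norm ?u + l2_norm (wd ?u)))"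
      by (rule order_trans[OF ii(2) mult_left_mono[OF Tu(2) C(1)]])
    also have "l2_norm (\<lambda>x. ?t * wd p x) \<le> fracI_bound \<alpha> * l2_norm (wd p) * (l2_norm ?u + l2_norm (wd ?u))"
    proof -
      have "\<bar>?t\<bar> * l2_norm (wd p) \<le> (fracI_bound \<alpha> * l2_norm ?u) * l2_norm (wd p)"
        by (intro mult_right_mono fracI_le[OF \<alpha> u]) auto
      also have "\<dots> = (fracI_bound \<alpha> * l2_norm (wd p)) * l2_norm ?u" by simp
      also have "\<dots> \<le> (fracI_bound \<alpha> * l2_norm (wd p)) * (l2_norm ?u + l2_norm (wd ?u))"
        using fracI_bound by (intro mult_left_mono) auto
      finally show ?thesis by (simp only: l2_norm_cmult)
    qed
    finally show ?thesis using H(1) by (simp add: algebra_simps)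
  qed
  moreover have "0 \<le> ?K" using fracI_bound C(1) by simp
  ultimately show ?thesis using that by blast
qed

end

lemma H2_norm_le: "H2_norm u \<le> l2_norm u + l2_norm (wd u) + l2_norm (wd (wd u))"
  unfolding H2_norm_def
  by (rule real_le_lsqrt) (simp_all add: power2_eq_square algebra_simps)

lemma H3_norm_le: "H3_norm u \<le> l2_norm u + l2_norm (wd u) + l2_norm (wd (wd u)) + l2_norm (wd (wd (wd u)))"
  unfolding H3_norm_def
  by (rule real_le_lsqrt) (simp_all add: power2_eq_square algebra_simps)

theorem theorem3p2:
  fixes \<alpha> :: real and q p :: "real \<Rightarrow> real"
  assumes "3/2 < \<alpha>" and "\<alpha> < 2"
    and "Linf q" and "L2 p"
    and a: "\<And>w. H10 w \<Longrightarrow> (\<forall>v. H10 v \<longrightarrow> A_form \<alpha> q p w v = 0) \<Longrightarrow> ae_zero w"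
    and a_star: "\<And>v. H10 v \<Longrightarrow> (\<forall>w. H10 w \<longrightarrow> A_form \<alpha> q p w v = 0) \<Longrightarrow> ae_zero v"
  shows "(\<exists>c. \<forall>f w. L2 f \<and> H10 w \<and>
              (\<forall>\<phi>. H10 \<phi> \<longrightarrow> A_form \<alpha> q p w \<phi> = l2_inner f \<phi>) \<longrightarrow>
              H10 w \<and> H2 w \<and> H2_norm w \<le> c * l2_norm f)
       \<and> (H1 q \<and> H1 p \<longrightarrow>
            (\<exists>c. \<forall>f w. H1 f \<and> H10 w \<and>
              (\<forall>\<phi>. H10 \<phi> \<longrightarrow> A_form \<alpha> q p w \<phi> = l2_inner f \<phi>) \<longrightarrow>
              H10 w \<and> H3 w \<and> H3_norm w \<le> c * H1_norm f))"
proof -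
  obtain c where c: "0 \<le> c" "\<And>f w. sol \<alpha> q p f w \<Longrightarrow> H2 w"
    "\<And>f w. sol \<alpha> q p f w \<Longrightarrow> l2_norm w + l2_norm (wd w) + l2_norm (wd (wd w)) \<le> c * l2_norm f"
    using sol_H2[OF assms(1-4) a] by blast
  have "H10 w \<and> H2 w \<and> H2_norm w \<le> c * l2_norm f" if "sol \<alpha> q p f w" for f w
    using that c(2,3)[OF that] H2_norm_le[of w] by (auto simp: sol_def)
  moreover have "\<exists>c. \<forall>f w. H1 f \<and> sol \<alpha> q p f w \<longrightarrow> H10 w \<and> H3 w \<and> H3_norm w \<le> c * H1_norm f"
    if qp: "H1 q" "H1 p"
  proof -
    obtain K where K: "0 \<le> K" "\<And>f w. sol \<alpha> q p f w \<Longrightarrow> H1 f \<Longrightarrow> H1 (wd (wd w))"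
      "\<And>f w. sol \<alpha> q p f w \<Longrightarrow> H1 f \<Longrightarrow>
         l2_norm (wd (wd (wd w))) \<le> K * (l2_norm (wd w) + l2_norm (wd (wd w))) + l2_norm (wd f)"
      using sol_third_deriv[OF assms(1-4) qp] by blast
    \<comment> \<open>In the constant, c covers the H2 part, K c the lower derivatives in the bound
      of w''', and 1 the term ||f'||.\<close>
    have "H10 w \<and> H3 w \<and> H3_norm w \<le> (c + K * c + 1) * H1_norm f" if f: "H1 f" and s: "sol \<alpha> q p f w" for f w
    proof (intro conjI)
      show "H10 w" using s by (auto simp: sol_def)
      show "H3 w" using c(2)[OF s] K(2)[OF s f] by (auto simp: H3_def H2_def)
      let ?n = "l2_norm w + l2_norm (wd w) + l2_norm (wd (wd w))"
      have "K * (l2_norm (wd w) + l2_norm (wd (wd w))) \<le> K * ?n" using K(1) by (intro mult_left_mono) auto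
      also have "\<dots> \<le> K * (c * l2_norm f)" by (intro mult_left_mono c(3)[OF s] K(1))
      finally have "H3_norm w \<le> c * l2_norm f + K * (c * l2_norm f) + l2_norm (wd f)"
        using H3_norm_le[of w] c(3)[OF s] K(3)[OF s f] by linarith
      also have "\<dots> \<le> c * H1_norm f + K * (c * H1_norm f) + H1_norm f"
        using c(1) K(1) by (intro add_mono mult_left_mono H1_norm_ge) auto
      finally show "H3_norm w \<le> (c + K * c + 1) * H1_norm f" by (simp add: algebra_simps)
    qed
    then show ?thesis by blast
  qed
  ultimately show ?thesis unfolding sol_def using H1_L2 by blast
qed

end
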